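(* Let $\{x^k\}_k$, $\{z^k\}_k$ be generated by the normal map-based stochastic proximal gradient method described in the context and suppose conditions (A.1), (A.3), (B.1) and (B.2) hold, and that $\sum_{k=0}^\infty\alpha_k^2\max\{\mathsf A,\sigma_k^2\}<\infty$. Then: (a) $\|F^\lambda_{\mathrm{nor}}(z^k)\|\to0$, $\|F^\lambda_{\mathrm{nat}}(x^k)\|\to0$ and $\psi(x^k)\to\psi^*$ almost surely, where $\psi^*:\Omega\to\mathbb R$ is some random variable; (b) $\mathbb E[\|F^\lambda_{\mathrm{nor}}(z^k)\|^2]\to0$, $\mathbb E[\|F^\lambda_{\mathrm{nat}}(x^k)\|^2]\to0$ and $\mathbb E[\psi(x^k)]\to\rho^*$ for some constant $\rho^*\in\mathbb R$.
   Context: Let $\varphi:\mathbb{R}^d\to(-\infty,\infty]$ be convex, lower semicontinuous and proper, let $f:\mathbb{R}^d\to\mathbb{R}$ be continuously differentiable, and set $\psi=f+\varphi$. For $\lambda>0$ let $\mathrm{prox}_{\lambda\varphi}(x)=\operatorname{argmin}_y\{\varphi(y)+\frac{1}{2\lambda}\|x-y\|^2\}$, $\mathrm{env}_{\lambda\varphi}$ the Moreau envelope with $\nabla\mathrm{env}_{\lambda\varphi}(x)=(x-\mathrm{prox}_{\lambda\varphi}(x))/\lambda$, $F^\lambda_{\mathrm{nor}}(z)=\nabla f(\mathrm{prox}_{\lambda\varphi}(z))+\frac1\lambda(z-\mathrm{prox}_{\lambda\varphi}(z))$ and $F^\lambda_{\mathrm{nat}}(x)=x-\mathrm{prox}_{\lambda\varphi}(x-\lambda\nabla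 f(x))$. Method: on a filtered probability space $(\Omega,\mathcal F,\{\mathcal F_k\}_k,\mathbb P)$, with $\lambda>0$, step sizes $\alpha_k>0$, deterministic $z^0$, $x^0=\mathrm{prox}_{\lambda\varphi}(z^0)$, and $\mathcal F_{k+1}$-measurable random vectors $g^k$, set $z^{k+1}=z^k-\alpha_k(g^k+\nabla\mathrm{env}_{\lambda\varphi}(z^k))$, $x^{k+1}=\mathrm{prox}_{\lambda\varphi}(z^{k+1})$. Let $e^k=g^k-\nabla f(x^k)$. Conditions: (A.1) There is $\bar\psi\in\mathbb R$ with $\psi(x)\ge\bar\psi$ for all $x\in\mathrm{dom}\,\varphi$. (A.3) $\sum_k\alpha_k=\infty$ and $\alpha_k\to0$. (B.1) $\nabla f$ is Lipschitz continuous on $\mathbb R^d$ with modulus $\mathsf L>0$. (B.2) $\mathbb E[g^k\mid\mathcal F_k]=\nabla f(x^k)$ a.s., and there are a constant $\mathsf A\ge0$ and $\{\sigma_k\}_k\subseteq\mathbb R_+$ with $\mathbb E[\|e^k\|^2\mid\mathcal F_k]\le\sigma_k^2+\mathsf A[\psi(x^k)-\bar\psi]$ a.s. for all $k$. *)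

theory Defs
  imports "HOL-Analysis.Analysis" "HOL-Probability.Probability"
begin

definition proper_fun :: "('a::euclidean_space \<Rightarrow> ereal) \<Rightarrow> bool" where
  "proper_fun \<phi> \<longleftrightarrow> (\<forall>x. \<phi> x \<noteq> -\<infinity>) \<and> (\<exists>x. \<phi> x \<noteq> \<infinity>)"

definition ext_convex :: "('a::euclidean_space \<Rightarrow> ereal) \<Rightarrow> bool" where
  "ext_convex \<phi> \<longleftrightarrow> (\<forall>x y u. 0 < u \<and> u < 1 \<longrightarrow>
      \<phi> ((1 - u) *\<^sub>R x + u *\<^sub>R y) \<le> ereal (1 - u) * \<phi> x + ereal u * \<phi> y)"

definition lsc :: "('a::euclidean_space \<Rightarrow> ereal) \<Rightarrow> bool" where
  "lsc \<phi> \<longleftrightarrow> (\<forall>x X. X \<longlonglongrightarrow> x \<longrightarrow> \<phi> x \<le> liminf (\<lambda>n. \<phi> (X n)))"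

definition dom_fun :: "('a::euclidean_space \<Rightarrow> ereal) \<Rightarrow> 'a set" where
  "dom_fun \<phi> = {x. \<phi> x \<noteq> \<infinity>}"

text \<open>prox_{lambda phi}(x) = argmin_y { phi(y) + ||x - y||^2 / (2 lambda) } (unique minimiser
for proper lsc convex phi).\<close>

definition prox :: "real \<Rightarrow> ('a::euclidean_space \<Rightarrow> ereal) \<Rightarrow> 'a \<Rightarrow> 'a" where
  "prox lam \<phi> x = (THE y. \<forall>w. \<phi> y + ereal (norm (x - y)^2 / (2 * lam))
                              \<le> \<phi> w + ereal (norm (x - w)^2 / (2 * lam)))"

definition grad_env :: "real \<Rightarrow> ('a::euclidean_space \<Rightarrow> ereal) \<Rightarrow> 'a \<Rightarrow> 'a" where
  "grad_env lam \<phi> x = (1 / lam) *\<^sub>R (x - prox lam \<phi> x)"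

definition F_nor :: "real \<Rightarrow> ('a::euclidean_space \<Rightarrow> 'a) \<Rightarrow> ('a \<Rightarrow> ereal) \<Rightarrow> 'a \<Rightarrow> 'a" where
  "F_nor lam f' \<phi> z = f' (prox lam \<phi> z) + (1 / lam) *\<^sub>R (z - prox lam \<phi> z)"

definition F_nat :: "real \<Rightarrow> ('a::euclidean_space \<Rightarrow> 'a) \<Rightarrow> ('a \<Rightarrow> ereal) \<Rightarrow> 'a \<Rightarrow> 'a" where
  "F_nat lam f' \<phi> x = x - prox lam \<phi> (x - lam *\<^sub>R f' x)"

definition psi :: "('a::euclidean_space \<Rightarrow> real) \<Rightarrow> ('a \<Rightarrow> ereal) \<Rightarrow> 'a \<Rightarrow> ereal" where
  "psi f \<phi> x = ereal (f x) + \<phi> x"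

end

theory Submission
  imports Defs
begin

text \<open>
  Write \<open>P\<close> for the proximal map, \<open>G\<close> for the normal map and \<open>Q = \<psi> \<circ> P\<close>; the method is
  \<open>z\<^sup>+ = z - \<alpha> (G z + e)\<close> with martingale noise \<open>e\<close>. The merit function \<open>H = Q + \<kappa> |G|\<^sup>2\<close>, for a small
  \<open>\<kappa>\<close>, decreases along a short step of length \<open>t\<close> by a multiple of \<open>t |G z|\<^sup>2\<close>, up to an error of
  order \<open>t |e|\<^sup>2\<close>. Since \<open>P\<close> is merely Lipschitz, this error is of first order in \<open>t\<close>, and summing it
  over single iterations is hopeless. Instead the iterations are grouped into windows of total step
  length between \<open>T/2\<close> and \<open>T\<close>, and each window is regarded as one step of the method. Its effective error
  consists of a drift, absorbed by the descent for small \<open>T\<close>, and of the accumulated noise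
  \<open>\<Sum> \<alpha>\<^sub>j e\<^sub>j\<close>, whose second moment is \<open>\<Sum> \<alpha>\<^sub>j\<^sup>2 E |e\<^sub>j|\<^sup>2\<close> by orthogonality and hence summable over the
  windows. This gives convergence along the window endpoints, pathwise and in mean. Inside the
  windows the displacement tends to zero, in mean by the same second moments and almost surely by
  Kolmogorov's maximal inequality and the Borel--Cantelli lemma.
\<close>

section \<open>The proximal map\<close>

text \<open>The term that blocks a one-iteration analysis is
  \<open>G z \<bullet> (P w - P z)\<close>: the proximal displacement depends nonlinearly on the
  noise, so conditional unbiasedness does not cancel its first-order part. What remains has size
  \<alpha> E|e|^2, while only \<alpha>^2 E|e|^2 can be expected to be summable. The way out is that
  the descent inequality is deterministic and holds for every vector e. A window of length t is
  therefore literally one step with some error u, where t u is drift plus accumulated noise, and the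
  cost D t |u|^2 = (D/t) |t u|^2 is quadratic in that noise because t stays above T/2. A second
  obstacle is that the noise variance is bounded through the merit value itself when A > 0. Expected
  merit and accumulated variance have to be bounded together inside each window; starting the
  windows where the tail of \<Sum> \<alpha>^2 max(A, \<sigma>^2) is small closes this loop. The
  result is a scalar recursion for unconditional expectations, and the almost sure statement is then
  deduced from expectation bounds that are summable over the windows.\<close>

lemma lsc_attains_min_compact:
  fixes h :: "'a::euclidean_space \<Rightarrow> ereal"
  assumes "lsc h" "compact S" "S \<noteq> {}"
  shows "\<exists>p\<in>S. \<forall>y\<in>S. h p \<le> h y"
proof -
  obtain u where u: "\<And>n. u n \<in> h ` S" "u \<longlonglongrightarrow> Inf (h ` S)"
    using Inf_as_limit[of "h ` S"] assms(3) by auto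
  have "\<forall>n. \<exists>y. y \<in> S \<and> u n = h y" using u(1) by blast
  then obtain Y where Y: "\<And>n. Y n \<in> S" "\<And>n. u n = h (Y n)" by metis
  obtain p r where pr: "p \<in> S" "strict_mono (r :: nat \<Rightarrow> nat)" "(Y \<circ> r) \<longlonglongrightarrow> p"
    using assms(2) Y(1) unfolding compact_def by blast
  have "h p \<le> liminf (\<lambda>n. h ((Y \<circ> r) n))"
    using assms(1) pr(3) unfolding lsc_def by blast
  also have "(\<lambda>n. h ((Y \<circ> r) n)) = u \<circ> r" using Y(2) by (auto simp: o_def)
  also have "liminf (u \<circ> r) = Inf (h ` S)"
    by (intro lim_imp_Liminf LIMSEQ_subseq_LIMSEQ u(2) pr(2)) simp
  finally show ?thesis using pr(1) by (meson INF_lower order_trans)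
qed

lemma lsc_add_continuous:
  fixes h :: "'a::euclidean_space \<Rightarrow> ereal" and c :: "'a \<Rightarrow> real"
  assumes "lsc h" "continuous_on UNIV c"
  shows "lsc (\<lambda>y. h y + ereal (c y))"
  unfolding lsc_def
proof (intro allI impI)
  fix x :: 'a and X assume X: "X \<longlonglongrightarrow> x"
  have "(\<lambda>n. c (X n)) \<longlonglongrightarrow> c x"
    using assms(2) X by (auto intro: continuous_on_tendsto_compose)
  hence c: "(\<lambda>n. ereal (c (X n))) \<longlonglongrightarrow> ereal (c x)" by simp
  have "liminf (\<lambda>n. ereal (c (X n)) + h (X n)) = ereal (c x) + liminf (\<lambda>n. h (X n))"
    by (rule ereal_liminf_lim_add[OF c]) auto
  moreover have "h x \<le> liminf (\<lambda>n. h (X n))" using assms(1) X unfolding lsc_def by blast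
  ultimately show "h x + ereal (c x) \<le> liminf (\<lambda>n. h (X n) + ereal (c (X n)))"
    by (subst (1 2) add.commute) (simp add: add_left_mono)
qed

text \<open>Lower semicontinuity gives a minimum m on the unit ball about a domain point
  \<open>x0\<close> with value a. Beyond the ball, convexity along the ray from \<open>x0\<close>
  limits the rate of decrease to a - m.\<close>

lemma proper_lsc_convex_linear_lower_bound:
  fixes \<phi> :: "'a::euclidean_space \<Rightarrow> ereal"
  assumes cvx: "ext_convex \<phi>" and l: "lsc \<phi>" and pr: "proper_fun \<phi>"
  obtains b c where "\<And>y. ereal (b - c * norm y) \<le> \<phi> y"
proof -
  obtain x0 where x0: "\<phi> x0 \<noteq> \<infinity>" using pr unfolding proper_fun_def by blast
  have ninf: "\<And>y. \<phi> y \<noteq> -\<infinity>" using pr unfolding proper_fun_def by blast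
  obtain a where a: "\<phi> x0 = ereal a" using x0 ninf[of x0] by (cases "\<phi> x0") auto
  obtain p where p: "p \<in> cball x0 1" "\<And>y. y \<in> cball x0 1 \<Longrightarrow> \<phi> p \<le> \<phi> y"
    using lsc_attains_min_compact[OF l, of "cball x0 1"] by auto
  have "\<phi> p \<le> ereal a" using p(2)[of x0] a by simp
  then obtain m where m: "\<phi> p = ereal m" using ninf[of p] by (cases "\<phi> p") auto
  have ma: "m \<le> a" using \<open>\<phi> p \<le> ereal a\<close> m by simp
  have main: "ereal (m - (a - m) * dist x0 y) \<le> \<phi> y" for y
  proof (cases "y \<in> cball x0 1")
    case True
    have "ereal (m - (a - m) * dist x0 y) \<le> ereal m" using ma by simp
    also have "\<dots> \<le> \<phi> y" using p(2)[OF True] m by simp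
    finally show ?thesis .
  next
    case False
    define r where "r = dist x0 y"
    have r: "r > 1" using False r_def by auto
    \<comment> \<open>The point where the segment from \<open>x0\<close> to \<open>y\<close> leaves
      the unit ball, so \<open>\<phi> q\<close> is at least m.\<close>
    define q where "q = (1 - 1/r) *\<^sub>R x0 + (1/r) *\<^sub>R y"
    have "q - x0 = (1/r) *\<^sub>R (y - x0)" by (simp add: q_def algebra_simps)
    moreover have "x0 \<noteq> y" using r r_def by auto
    ultimately have "dist x0 q = 1" by (simp add: dist_norm norm_minus_commute r_def)
    hence "\<phi> p \<le> \<phi> q" using p(2)[of q] by simp
    also have "\<phi> q \<le> ereal (1 - 1/r) * \<phi> x0 + ereal (1/r) * \<phi> y"
      using cvx r unfolding ext_convex_def q_def by auto
    finally have le: "ereal m \<le> ereal (1 - 1/r) * ereal a + ereal (1/r) * \<phi> y" using m a by simp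
    show ?thesis
    proof (cases "\<phi> y")
      case (real s)
      have "m \<le> (1 - 1/r) * a + (1/r) * s" using le real by simp
      hence "r * m \<le> r * ((1 - 1/r) * a + (1/r) * s)" using r by (intro mult_left_mono) auto
      also have "\<dots> = r * a - a + s" using r by (simp add: field_simps)
      finally have "a - (a - m) * r \<le> s" by (simp add: algebra_simps)
      thus ?thesis using real ma r_def by simp
    qed (use ninf in auto)
  qed
  have "ereal ((m - (a - m) * norm x0) - (a - m) * norm y) \<le> \<phi> y" for y
  proof -
    have "(a - m) * dist x0 y \<le> (a - m) * (norm x0 + norm y)"
      using ma by (intro mult_left_mono) (auto simp: dist_norm norm_triangle_ineq4)
    hence "(m - (a - m) * norm x0) - (a - m) * norm y \<le> m - (a - m) * dist x0 y"
      by (simp add: algebra_simps)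
    thus ?thesis using main[of y] by (meson ereal_less_eq(3) order_trans)
  qed
  thus ?thesis by (rule that)
qed

lemma prox_minimizer_exists:
  fixes \<phi> :: "'a::euclidean_space \<Rightarrow> ereal"
  assumes cvx: "ext_convex \<phi>" and l: "lsc \<phi>" and pr: "proper_fun \<phi>" and lam: "lam > 0"
  shows "\<exists>p. \<forall>w. \<phi> p + ereal (norm (x - p)^2 / (2 * lam)) \<le> \<phi> w + ereal (norm (x - w)^2 / (2 * lam))"
proof -
  let ?h = "\<lambda>w. \<phi> w + ereal (norm (x - w)^2 / (2 * lam))"
  obtain b c where bc: "\<And>y. ereal (b - c * norm y) \<le> \<phi> y"
    using proper_lsc_convex_linear_lower_bound[OF cvx l pr] by blast
  obtain x0 where x0: "\<phi> x0 \<noteq> \<infinity>" using pr unfolding proper_fun_def by blast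
  then obtain v where v: "?h x0 = ereal v"
    using pr unfolding proper_fun_def by (cases "\<phi> x0") auto
  \<comment> \<open>With s = r - norm x, the first summand makes s^2 / (2 lam) at least (|c| + 1) s.
    The part |c| s offsets the linear lower bound, and the second summand makes the remaining s
    exceed v - b + |c| norm x.\<close>
  define N where "N = norm x + (2 * lam * (\<bar>c\<bar> + 1) + \<bar>v - b + \<bar>c\<bar> * norm x\<bar> + 1)"
  have N: "v < b - \<bar>c\<bar> * r + (r - norm x)^2 / (2 * lam)" if "r \<ge> N" for r
  proof -
    define s where "s = r - norm x"
    have c: "0 \<le> 2 * lam * (\<bar>c\<bar> + 1)" using lam by simp
    have s1: "2 * lam * (\<bar>c\<bar> + 1) \<le> s" and s2: "v - b + \<bar>c\<bar> * norm x < s"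
      using that c unfolding N_def s_def by linarith+
    have "0 \<le> s" using s1 c by linarith
    hence "(2 * lam * (\<bar>c\<bar> + 1)) * s \<le> s * s" by (intro mult_right_mono s1)
    hence "(\<bar>c\<bar> + 1) * s \<le> s^2 / (2 * lam)" using lam by (simp add: field_simps power2_eq_square)
    moreover have "r = s + norm x" by (simp add: s_def)
    ultimately show ?thesis using s2 by (simp add: algebra_simps)
  qed
  \<comment> \<open>Including \<open>norm x0\<close> puts a point of value v into the ball;
    including \<open>norm x\<close> keeps norm w - norm x nonnegative outside, as squaring
    requires.\<close>
  define B where "B = max N (max (norm x) (norm x0))"
  have out: "ereal v \<le> ?h w" if "norm w \<ge> B" for w
  proof -
    have "v < b - \<bar>c\<bar> * norm w + (norm w - norm x)^2 / (2 * lam)" using N that B_def by auto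
    also have "(norm w - norm x)^2 \<le> norm (x - w)^2"
      using that B_def norm_triangle_ineq2[of w x]
      by (intro power_mono) (auto simp: norm_minus_commute)
    hence "b - \<bar>c\<bar> * norm w + (norm w - norm x)^2 / (2 * lam)
         \<le> b - c * norm w + norm (x - w)^2 / (2 * lam)"
      using lam by (intro add_mono diff_mono divide_right_mono mult_right_mono) auto
    finally have "ereal v \<le> ereal (b - c * norm w) + ereal (norm (x - w)^2 / (2 * lam))" by simp
    also have "\<dots> \<le> ?h w" by (intro add_mono bc order_refl)
    finally show ?thesis .
  qed
  have "lsc ?h" by (intro lsc_add_continuous l continuous_intros) (use lam in auto)
  moreover have x0B: "x0 \<in> cball 0 B" by (auto simp: B_def)
  ultimately have "\<exists>p\<in>cball 0 B. \<forall>y\<in>cball 0 B. ?h p \<le> ?h y"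
    by (intro lsc_attains_min_compact) (auto simp del: cball_eq_empty mem_cball_0)
  then obtain p where p: "\<And>y. y \<in> cball 0 B \<Longrightarrow> ?h p \<le> ?h y" by blast
  have "?h p \<le> ?h w" for w
  proof (cases "norm w \<ge> B")
    case True
    have "?h p \<le> ereal v" using p[OF x0B] v by simp
    also have "\<dots> \<le> ?h w" by (rule out[OF True])
    finally show ?thesis .
  qed (use p in auto)
  thus ?thesis by blast
qed

text \<open>First-order optimality without differentiability: compare \<open>p\<close> with the
  point a fraction u of the way to \<open>w\<close>, cancel u and let u tend to 0, so that only the
  linear part of the quadratic survives.\<close>

lemma prox_minimizer_subgradient:
  fixes \<phi> :: "'a::euclidean_space \<Rightarrow> ereal"
  assumes cvx: "ext_convex \<phi>" and pr: "proper_fun \<phi>" and lam: "lam > 0"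
    and p: "\<And>w. \<phi> p + ereal (norm (x - p)^2 / (2 * lam)) \<le> \<phi> w + ereal (norm (x - w)^2 / (2 * lam))"
  obtains a where "\<phi> p = ereal a" "\<And>w. ereal (a + (1/lam) * ((x - p) \<bullet> (w - p))) \<le> \<phi> w"
proof -
  have ninf: "\<And>y. \<phi> y \<noteq> -\<infinity>" using pr unfolding proper_fun_def by blast
  obtain x0 where x0: "\<phi> x0 \<noteq> \<infinity>" using pr unfolding proper_fun_def by blast
  have "\<phi> p \<noteq> \<infinity>" using p[of x0] x0 by auto
  then obtain a where a: "\<phi> p = ereal a" using ninf[of p] by (cases "\<phi> p") auto
  have "ereal (a + (1/lam) * ((x - p) \<bullet> (w - p))) \<le> \<phi> w" for w
  proof (cases "\<phi> w")
    case (real s)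
    let ?i = "(x - p) \<bullet> (w - p)" and ?n = "norm (w - p)^2"
    have step: "a + (1/lam) * ?i \<le> s + u * (?n / (2 * lam))" if u: "0 < u" "u < 1" for u
    proof -
      let ?q = "(1 - u) *\<^sub>R p + u *\<^sub>R w"
      have "\<phi> ?q \<le> ereal (1 - u) * \<phi> p + ereal u * \<phi> w"
        using cvx u unfolding ext_convex_def by blast
      hence "\<phi> ?q \<le> ereal ((1 - u) * a + u * s)" using a real by simp
      hence "\<phi> p + ereal (norm (x - p)^2 / (2 * lam))
          \<le> ereal ((1 - u) * a + u * s) + ereal (norm (x - ?q)^2 / (2 * lam))"
        using p[of ?q] by (meson add_right_mono order_trans)
      hence "a + norm (x - p)^2 / (2 * lam) \<le> (1 - u) * a + u * s + norm (x - ?q)^2 / (2 * lam)"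
        using a by simp
      moreover have "x - ?q = (x - p) - u *\<^sub>R (w - p)" by (simp add: algebra_simps)
      hence "norm (x - ?q)^2 = norm (x - p)^2 - 2 * u * ?i + u^2 * ?n"
        by (simp only: power2_norm_eq_inner)
          (simp add: inner_diff_left inner_diff_right inner_commute algebra_simps power2_eq_square)
      hence "norm (x - ?q)^2 / (2 * lam)
          = norm (x - p)^2 / (2 * lam) - u * ((1/lam) * ?i) + u * (u * (?n / (2 * lam)))"
        using lam by (simp add: divide_simps) (simp add: algebra_simps power2_eq_square)
      ultimately have "u * (a + (1/lam) * ?i) \<le> u * (s + u * (?n / (2 * lam)))"
        by (simp only: distrib_left left_diff_distrib)
      thus ?thesis using u by simp
    qed
    have "((\<lambda>u. s + u * (?n / (2 * lam))) \<longlongrightarrow> s + 0 * (?n / (2 * lam))) (at_right 0)"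
      by (intro tendsto_intros)
    moreover have "\<forall>\<^sub>F u in at_right 0. a + (1/lam) * ?i \<le> s + u * (?n / (2 * lam))"
      unfolding eventually_at_right_field using step by (intro exI[of _ 1]) simp
    ultimately have "a + (1/lam) * ?i \<le> s + 0 * (?n / (2 * lam))"
      by (intro tendsto_lowerbound[where F = "at_right 0"]) auto
    thus ?thesis using real by simp
  qed (use ninf in auto)
  thus ?thesis using a that by blast
qed

text \<open>Test each subgradient inequality at the other minimiser and add. Besides firm
  nonexpansiveness, the case x = y yields uniqueness, which justifies the definite description in
  \<open>prox\<close>.\<close>

lemma prox_minimizers_monotone:
  fixes \<phi> :: "'a::euclidean_space \<Rightarrow> ereal"
  assumes cvx: "ext_convex \<phi>" and pr: "proper_fun \<phi>" and lam: "lam > 0"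
    and p: "\<And>w. \<phi> p + ereal (norm (x - p)^2 / (2 * lam)) \<le> \<phi> w + ereal (norm (x - w)^2 / (2 * lam))"
    and q: "\<And>w. \<phi> q + ereal (norm (y - q)^2 / (2 * lam)) \<le> \<phi> w + ereal (norm (y - w)^2 / (2 * lam))"
  shows "norm (q - p)^2 \<le> (y - x) \<bullet> (q - p)"
proof -
  obtain a where a: "\<phi> p = ereal a" "\<And>w. ereal (a + (1/lam) * ((x - p) \<bullet> (w - p))) \<le> \<phi> w"
    using prox_minimizer_subgradient[OF cvx pr lam p] by blast
  obtain b where b: "\<phi> q = ereal b" "\<And>w. ereal (b + (1/lam) * ((y - q) \<bullet> (w - q))) \<le> \<phi> w"
    using prox_minimizer_subgradient[OF cvx pr lam q] by blast
  have "(1/lam) * ((x - p) \<bullet> (q - p) + (y - q) \<bullet> (p - q)) \<le> 0"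
    using a(2)[of q] b(2)[of p] a(1) b(1) by (simp add: distrib_left)
  hence "(x - p) \<bullet> (q - p) + (y - q) \<bullet> (p - q) \<le> 0" using lam by (simp add: divide_le_0_iff)
  thus ?thesis
    by (simp add: power2_norm_eq_inner inner_diff_left inner_diff_right inner_commute)
qed

lemma prox_is_minimizer:
  fixes \<phi> :: "'a::euclidean_space \<Rightarrow> ereal"
  assumes cvx: "ext_convex \<phi>" and l: "lsc \<phi>" and pr: "proper_fun \<phi>" and lam: "lam > 0"
  shows "\<phi> (prox lam \<phi> x) + ereal (norm (x - prox lam \<phi> x)^2 / (2 * lam))
       \<le> \<phi> w + ereal (norm (x - w)^2 / (2 * lam))"
proof -
  let ?m = "\<lambda>y. \<forall>w. \<phi> y + ereal (norm (x - y)^2 / (2 * lam)) \<le> \<phi> w + ereal (norm (x - w)^2 / (2 * lam))"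
  obtain p where p: "?m p" using prox_minimizer_exists[OF assms] by blast
  have "q = p" if "?m q" for q
    using prox_minimizers_monotone[OF cvx pr lam, of p x q x] p that by simp
  hence "?m (THE y. ?m y)" using p by (intro theI[of ?m p]) blast+
  thus ?thesis unfolding prox_def by blast
qed

lemma
  fixes \<phi> :: "'a::euclidean_space \<Rightarrow> ereal"
  assumes cvx: "ext_convex \<phi>" and l: "lsc \<phi>" and pr: "proper_fun \<phi>" and lam: "lam > 0"
  shows prox_firmly_nonexpansive:
      "norm (prox lam \<phi> w - prox lam \<phi> z)^2 \<le> (w - z) \<bullet> (prox lam \<phi> w - prox lam \<phi> z)"
    and prox_nonexpansive: "norm (prox lam \<phi> w - prox lam \<phi> z) \<le> norm (w - z)"
    and phi_prox_finite: "\<phi> (prox lam \<phi> z) = ereal (real_of_ereal (\<phi> (prox lam \<phi> z)))"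
    and prox_subgradient: "real_of_ereal (\<phi> (prox lam \<phi> z))
        + (1/lam) * ((z - prox lam \<phi> z) \<bullet> (prox lam \<phi> w - prox lam \<phi> z))
        \<le> real_of_ereal (\<phi> (prox lam \<phi> w))"
proof -
  note m = prox_is_minimizer[OF assms]
  show 1: "norm (prox lam \<phi> w - prox lam \<phi> z)^2 \<le> (w - z) \<bullet> (prox lam \<phi> w - prox lam \<phi> z)"
    for z w by (rule prox_minimizers_monotone[OF cvx pr lam m m])
  have "norm (prox lam \<phi> w - prox lam \<phi> z)^2 \<le> norm (w - z) * norm (prox lam \<phi> w - prox lam \<phi> z)"
    using 1 norm_cauchy_schwarz order_trans by blast
  thus "norm (prox lam \<phi> w - prox lam \<phi> z) \<le> norm (w - z)"
    by (cases "norm (prox lam \<phi> w - prox lam \<phi> z) = 0") (auto simp: power2_eq_square)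
  show fin: "\<phi> (prox lam \<phi> z) = ereal (real_of_ereal (\<phi> (prox lam \<phi> z)))" for z
    using prox_minimizer_subgradient[OF cvx pr lam m[of z]] by (metis real_of_ereal.simps(1))
  obtain a where a: "\<phi> (prox lam \<phi> z) = ereal a"
      "\<And>w. ereal (a + (1/lam) * ((z - prox lam \<phi> z) \<bullet> (w - prox lam \<phi> z))) \<le> \<phi> w"
    using prox_minimizer_subgradient[OF cvx pr lam m[of z]] by blast
  show "real_of_ereal (\<phi> (prox lam \<phi> z))
        + (1/lam) * ((z - prox lam \<phi> z) \<bullet> (prox lam \<phi> w - prox lam \<phi> z))
        \<le> real_of_ereal (\<phi> (prox lam \<phi> w))"
    using a(2)[of "prox lam \<phi> w"] a(1) fin[of w]
    by (metis ereal_less_eq(3) real_of_ereal.simps(1))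
qed

section \<open>The normal map and its merit function\<close>

text \<open>Mean value theorem on the segment, with the intermediate gradient compared to the one at
  \<open>y\<close>. This gives L instead of the sharp L/2, which affects constants only.\<close>

lemma gradient_lipschitz_upper_bound:
  fixes f :: "'a::euclidean_space \<Rightarrow> real"
  assumes grad: "\<And>y. GDERIV f y :> f' y" and lip: "L-lipschitz_on UNIV f'"
  shows "f w \<le> f y + f' y \<bullet> (w - y) + L * norm (w - y)^2"
proof -
  let ?l = "\<lambda>s::real. y + s *\<^sub>R (w - y)"
  have "((\<lambda>s. f (?l s)) has_derivative (\<lambda>s. s * ((w - y) \<bullet> f' (?l t)))) (at t)" for t
  proof -
    have "((\<lambda>s. f (?l s)) has_derivative (\<lambda>s. (s *\<^sub>R (w - y)) \<bullet> f' (?l t))) (at t)"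
      using grad[of "?l t"] unfolding gderiv_def
      by (intro has_derivative_compose[of ?l "\<lambda>s. s *\<^sub>R (w - y)" t UNIV f])
        (auto intro!: derivative_eq_intros)
    thus ?thesis by simp
  qed
  hence "\<And>t. ((\<lambda>s. f (?l s)) has_real_derivative ((w - y) \<bullet> f' (?l t))) (at t)"
    by (simp add: has_field_derivative_def mult.commute mult_commute_abs)
  then obtain t where t: "0 < t" "t < 1" "f (?l 1) - f (?l 0) = (1 - 0) * ((w - y) \<bullet> f' (?l t))"
    using MVT2[of 0 1 "\<lambda>s. f (?l s)" "\<lambda>t. (w - y) \<bullet> f' (?l t)"] by auto
  have "(w - y) \<bullet> (f' (?l t) - f' y) \<le> norm (w - y) * norm (f' (?l t) - f' y)"
    by (rule norm_cauchy_schwarz)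
  also have "norm (f' (?l t) - f' y) \<le> L * norm (t *\<^sub>R (w - y))"
    using lipschitz_onD[OF lip, of "?l t" y] by (simp add: dist_norm)
  also have "\<dots> \<le> L * norm (w - y)"
    using t lipschitz_on_nonneg[OF lip] by (intro mult_left_mono) (auto simp: mult_left_le_one_le)
  finally have "(w - y) \<bullet> (f' (?l t) - f' y) \<le> norm (w - y) * (L * norm (w - y))"
    by (simp add: mult_left_mono)
  thus ?thesis using t(3)
    by (simp add: inner_diff_right inner_commute power2_eq_square mult_ac)
qed

locale composite_problem =
  fixes \<phi> :: "'a::euclidean_space \<Rightarrow> ereal" and f :: "'a \<Rightarrow> real" and f' :: "'a \<Rightarrow> 'a"
    and lam L :: real
  assumes phi_convex: "ext_convex \<phi>" and phi_lsc: "lsc \<phi>" and phi_proper: "proper_fun \<phi>"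
    and f_grad: "\<And>y. GDERIV f y :> f' y" and f'_lip: "L-lipschitz_on UNIV f'"
    and lam_pos: "lam > 0"
begin

abbreviation P where "P \<equiv> prox lam \<phi>"
abbreviation G where "G \<equiv> F_nor lam f' \<phi>"

text \<open>Passing to reals loses nothing, because \<open>\<phi>\<close> is finite at every
  proximal point.\<close>

definition Q :: "'a \<Rightarrow> real" where "Q z = f (P z) + real_of_ereal (\<phi> (P z))"

definition K :: real where "K = L + 1 / lam"

lemma L_nonneg: "L \<ge> 0" using f'_lip lipschitz_on_nonneg by blast

lemma K_bounds: "K > 0" "L \<le> K" "1 / lam \<le> K"
  using L_nonneg lam_pos by (auto simp: K_def add_nonneg_pos)

lemmas firm = prox_firmly_nonexpansive[OF phi_convex phi_lsc phi_proper lam_pos]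
lemmas nonexp = prox_nonexpansive[OF phi_convex phi_lsc phi_proper lam_pos]

lemma psi_prox: "psi f \<phi> (P z) = ereal (Q z)"
  unfolding psi_def Q_def
  by (subst phi_prox_finite[OF phi_convex phi_lsc phi_proper lam_pos]) simp

lemma f'_diff: "norm (f' (P w) - f' (P z)) \<le> L * norm (P w - P z)"
  using lipschitz_onD[OF f'_lip, of "P w" "P z"] by (simp add: dist_norm)

text \<open>The remainder is bounded by the displacement of \<open>P\<close>, not by that of the
  argument. This matters in \<open>merit_descent\<close>, where the decrease of \<open>Q\<close>
  supplies a negative multiple of exactly this squared displacement.\<close>

lemma G_diff:
  "\<exists>q. G w = G z + (1/lam) *\<^sub>R (w - z) + q \<and> norm q \<le> K * norm (P w - P z)"
proof (intro exI conjI)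
  let ?q = "(f' (P w) - f' (P z)) - (1/lam) *\<^sub>R (P w - P z)"
  show "G w = G z + (1/lam) *\<^sub>R (w - z) + ?q" by (simp add: F_nor_def algebra_simps)
  have "norm ?q \<le> norm (f' (P w) - f' (P z)) + norm ((1/lam) *\<^sub>R (P w - P z))"
    by (rule norm_triangle_ineq4)
  also have "\<dots> \<le> L * norm (P w - P z) + (1/lam) * norm (P w - P z)"
    using f'_diff lam_pos by (intro add_mono) auto
  finally show "norm ?q \<le> K * norm (P w - P z)" by (simp add: K_def distrib_right)
qed

lemma G_lipschitz: "norm (G w - G z) \<le> 2 * K * norm (w - z)"
proof -
  obtain q where q: "G w = G z + (1/lam) *\<^sub>R (w - z) + q" "norm q \<le> K * norm (P w - P z)"
    using G_diff by blast
  have "norm (G w - G z) = norm ((1/lam) *\<^sub>R (w - z) + q)" using q(1) by simp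
  also have "\<dots> \<le> norm ((1/lam) *\<^sub>R (w - z)) + norm q" by (rule norm_triangle_ineq)
  also have "\<dots> \<le> K * norm (w - z) + K * norm (w - z)"
  proof (intro add_mono)
    show "norm ((1/lam) *\<^sub>R (w - z)) \<le> K * norm (w - z)"
      using K_bounds(3) lam_pos by (simp add: mult_right_mono divide_inverse mult.commute)
    show "norm q \<le> K * norm (w - z)"
      using q(2) nonexp K_bounds(1) by (meson less_imp_le mult_left_mono order_trans)
  qed
  finally show ?thesis by simp
qed

text \<open>The subgradient is taken at \<open>P w\<close>, since \<open>\<phi>\<close> has to be
  bounded from above there. Moving it back to \<open>z\<close> produces the term with
  \<open>w - z\<close> and a favourable -|d|^2 / lam, which is discarded.\<close>

lemma Q_diff_inner:
  "Q w - Q z \<le> G z \<bullet> (P w - P z) + (1/lam) * ((w - z) \<bullet> (P w - P z)) + L * norm (P w - P z)^2"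
proof -
  let ?d = "P w - P z"
  have f: "f (P w) \<le> f (P z) + f' (P z) \<bullet> ?d + L * norm ?d^2"
    by (rule gradient_lipschitz_upper_bound[OF f_grad f'_lip])
  have "real_of_ereal (\<phi> (P w)) + (1/lam) * ((w - P w) \<bullet> (P z - P w)) \<le> real_of_ereal (\<phi> (P z))"
    by (rule prox_subgradient[OF phi_convex phi_lsc phi_proper lam_pos])
  moreover have "(w - P w) \<bullet> (P z - P w) = - ((z - P z) \<bullet> ?d) - (w - z) \<bullet> ?d + norm ?d^2"
    by (simp add: power2_norm_eq_inner inner_diff_left inner_diff_right inner_commute)
  ultimately have "real_of_ereal (\<phi> (P w)) + (1/lam) * (norm ?d^2)
      \<le> real_of_ereal (\<phi> (P z)) + (1/lam) * ((z - P z) \<bullet> ?d) + (1/lam) * ((w - z) \<bullet> ?d)"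
    by (simp only: distrib_left right_diff_distrib)
  moreover have "(1/lam) * (norm ?d^2) \<ge> 0" using lam_pos by simp
  moreover have "G z \<bullet> ?d = f' (P z) \<bullet> ?d + (1/lam) * ((z - P z) \<bullet> ?d)"
    by (simp add: F_nor_def inner_add_left)
  ultimately show ?thesis using f unfolding Q_def by linarith
qed

lemma Q_diff_le: "Q w - Q z \<le> norm (G z) * norm (w - z) + 2 * K * norm (w - z)^2"
proof -
  let ?d = "P w - P z"
  have "G z \<bullet> ?d \<le> norm (G z) * norm (w - z)"
    by (meson mult_left_mono nonexp norm_cauchy_schwarz norm_ge_zero order_trans)
  moreover have "(1/lam) * ((w - z) \<bullet> ?d) \<le> K * norm (w - z)^2"
  proof (intro mult_mono K_bounds(3))
    show "(w - z) \<bullet> ?d \<le> norm (w - z)^2" unfolding power2_eq_square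
      by (meson mult_left_mono nonexp norm_cauchy_schwarz norm_ge_zero order_trans)
    show "0 \<le> (w - z) \<bullet> ?d" using firm[of w z] zero_le_power2 order_trans by blast
  qed (use K_bounds in auto)
  moreover have "L * norm ?d^2 \<le> K * norm (w - z)^2"
    using L_nonneg K_bounds nonexp by (intro mult_mono power_mono) auto
  ultimately show ?thesis using Q_diff_inner[of w z] by linarith
qed

text \<open>The one-sided bound applied in both directions; exchanging \<open>G w\<close> for
  \<open>G z\<close> by Lipschitz continuity turns the constant 2 K into 4 K.\<close>

lemma Q_diff: "\<bar>Q w - Q z\<bar> \<le> norm (G z) * norm (w - z) + 4 * K * norm (w - z)^2"
proof -
  have "norm (G w) \<le> norm (G z) + 2 * K * norm (w - z)"
    using G_lipschitz[of w z] norm_triangle_ineq2[of "G w" "G z"] by linarith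
  hence "norm (G w) * norm (w - z) \<le> (norm (G z) + 2 * K * norm (w - z)) * norm (w - z)"
    by (rule mult_right_mono) simp
  hence "norm (G w) * norm (w - z) \<le> norm (G z) * norm (w - z) + 2 * K * norm (w - z)^2"
    by (simp add: algebra_simps power2_eq_square)
  moreover have "0 \<le> 2 * K * norm (w - z)^2" using K_bounds by simp
  ultimately show ?thesis
    using Q_diff_le[of w z] Q_diff_le[of z w] by (simp add: norm_minus_commute)
qed

text \<open>Chosen so that the prox-displacement term in the growth of |G|^2 becomes exactly |d|^2 /
  (4 t), the amount by which \<open>Q\<close> decreases.\<close>

definition kap :: real where "kap = 1 / (8 * lam * K^2)"

lemma kap_pos: "kap > 0" using K_bounds lam_pos by (simp add: kap_def)

text \<open>\<open>Q\<close> alone decreases only by a multiple of |d|^2, with d the displacement of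
  \<open>P\<close>, which may vanish although \<open>G z\<close> does not. |G|^2 contracts through
  the summand (w - z) / lam, up to a multiple of |d|^2. Their weighted sum cancels the |d|^2
  terms.\<close>

lemma merit_descent:
  assumes t: "0 < t" "t * K \<le> 1/8"
  shows "Q (z - t *\<^sub>R (G z + e)) + kap * norm (G (z - t *\<^sub>R (G z + e)))^2
    \<le> Q z + kap * norm (G z)^2 - (kap / lam) * t * norm (G z)^2 + (2 + 2 * kap / lam) * t * norm e^2"
proof -
  define w where "w = z - t *\<^sub>R (G z + e)"
  define d where "d = P w - P z"
  have wz: "w - z = - (t *\<^sub>R (G z + e))" by (simp add: w_def)
  have tl: "t / lam \<le> 1/8"
  proof -
    have "t / lam = t * (1/lam)" by simp
    also have "\<dots> \<le> t * K" using K_bounds(3) t(1) by (intro mult_left_mono) auto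
    finally show ?thesis using t(2) by linarith
  qed
  \<comment> \<open>The update rule is solved for \<open>G z\<close>, so the linear term becomes a
    firmly monotone one plus a noise term.\<close>
  have Gd: "G z \<bullet> d = - (1/t) * ((w - z) \<bullet> d) - e \<bullet> d"
    using t by (simp add: wz inner_add_left algebra_simps)
  have firmd: "norm d^2 \<le> (w - z) \<bullet> d" unfolding d_def by (rule firm)
  \<comment> \<open>Budget for \<open>Q\<close>: of the gain (1/t) (w - z).d, at most half is spent
    here. Firmness turns the other half into |d|^2 / (2t), and the next two estimates use |d|^2 /
    (8t) each, leaving |d|^2 / (4t).\<close>
  have "(1/lam) * ((w - z) \<bullet> d) \<le> (1/(2*t)) * ((w - z) \<bullet> d)"
    using tl t lam_pos firmd zero_le_power2[of "norm d"]
    by (intro mult_right_mono order_trans[OF zero_le_power2 firmd]) (auto simp: field_simps)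
  moreover have "L * norm d^2 \<le> (1/(8*t)) * norm d^2"
  proof (rule mult_right_mono)
    have "t * L \<le> t * K" using K_bounds(2) t by (intro mult_left_mono) auto
    hence "t * L \<le> 1/8" using t(2) by linarith
    thus "L \<le> 1/(8*t)" using t(1) by (simp add: field_simps)
  qed simp
  moreover have "- (e \<bullet> d) \<le> (1/(8*t)) * norm d^2 + 2 * t * norm e^2"
  proof -
    have "- (e \<bullet> d) \<le> norm e * norm d"
      using norm_cauchy_schwarz[of "-e" d] by simp
    moreover have "0 \<le> (norm d - 4 * t * norm e)^2 / (8 * t)" using t by simp
    hence "norm e * norm d \<le> (1/(8*t)) * norm d^2 + 2 * t * norm e^2"
      using t by (simp add: power2_diff field_simps power2_eq_square)
    ultimately show ?thesis by linarith
  qed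
  moreover have "- (1/(2*t)) * ((w - z) \<bullet> d) \<le> - (1/(2*t)) * norm d^2"
    using firmd t by (simp add: divide_right_mono)
  moreover have "Q w - Q z \<le> G z \<bullet> d + (1/lam) * ((w - z) \<bullet> d) + L * norm d^2"
    unfolding d_def by (rule Q_diff_inner)
  ultimately have Qd: "Q w - Q z \<le> - (1/(4*t)) * norm d^2 + 2 * t * norm e^2"
    unfolding Gd by (simp add: field_simps)
  obtain q where q: "G w = G z + (1/lam) *\<^sub>R (w - z) + q" "norm q \<le> K * norm d"
    using G_diff[of w z] unfolding d_def by blast
  define th where "th = t / lam"
  have th: "0 < th" "th \<le> 1/8" using t lam_pos tl by (auto simp: th_def)
  \<comment> \<open>Makes \<open>G w\<close> the convex combination of \<open>G z\<close> and
    \<open>u\<close> with weight th.\<close>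
  define u where "u = - e + (1/th) *\<^sub>R q"
  have Gw: "G w = (1 - th) *\<^sub>R G z + th *\<^sub>R u"
  proof -
    have "th *\<^sub>R u = q - th *\<^sub>R e" using th by (simp add: u_def scaleR_diff_right)
    moreover have "(1/lam) *\<^sub>R (w - z) = - (th *\<^sub>R G z) - th *\<^sub>R e"
      unfolding wz th_def by (simp add: scaleR_add_right scaleR_diff_right)
    ultimately show ?thesis using q(1) by (simp add: scaleR_diff_left)
  qed
  have "norm (G w) \<le> (1 - th) * norm (G z) + th * norm u"
    unfolding Gw using th by (intro norm_triangle_le) auto
  hence "norm (G w)^2 \<le> ((1 - th) * norm (G z) + th * norm u)^2" by (intro power_mono) auto
  \<comment> \<open>Convexity of the square as an identity: \<open>u\<close> enters with weight th,
    and no cross term with \<open>G z\<close> has to be estimated.\<close>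
  also have "\<dots> = (1 - th) * norm (G z)^2 + th * norm u^2 - th * (1 - th) * (norm (G z) - norm u)^2"
    by (simp add: power2_eq_square algebra_simps)
  also have "\<dots> \<le> (1 - th) * norm (G z)^2 + th * norm u^2" using th by simp
  finally have Gsq: "norm (G w)^2 \<le> (1 - th) * norm (G z)^2 + th * norm u^2" .
  have "norm u \<le> norm e + (1/th) * (K * norm d)"
  proof -
    have "norm u \<le> norm (- e) + norm ((1/th) *\<^sub>R q)" unfolding u_def by (rule norm_triangle_ineq)
    also have "\<dots> \<le> norm e + (1/th) * (K * norm d)"
      using q(2) th by (simp add: divide_right_mono)
    finally show ?thesis .
  qed
  hence "norm u^2 \<le> (norm e + (1/th) * (K * norm d))^2" by (intro power_mono) auto
  also have "\<dots> \<le> 2 * norm e^2 + 2 * ((1/th) * (K * norm d))^2"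
    using zero_le_power2[of "norm e - (1/th) * (K * norm d)"] by (simp add: power2_sum power2_diff)
  finally have "th * norm u^2 \<le> th * (2 * norm e^2 + 2 * ((1/th) * (K * norm d))^2)"
    using th by (intro mult_left_mono) auto
  also have "\<dots> = 2 * th * norm e^2 + (2/th) * K^2 * norm d^2"
    using th by (simp add: field_simps power2_eq_square)
  finally have "kap * norm (G w)^2 \<le> kap * ((1 - th) * norm (G z)^2 + (2 * th * norm e^2 + (2/th) * K^2 * norm d^2))"
    using Gsq kap_pos by (intro mult_left_mono) auto
  also have "\<dots> = kap * norm (G z)^2 - kap * th * norm (G z)^2 + 2 * kap * th * norm e^2
      + kap * ((2/th) * K^2 * norm d^2)" by (simp add: algebra_simps)
  also have "kap * ((2/th) * K^2 * norm d^2) = (1/(4*t)) * norm d^2"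
    using t lam_pos K_bounds(1) by (simp add: kap_def th_def field_simps)
  finally have Gd2: "kap * norm (G w)^2 \<le> kap * norm (G z)^2 - kap * th * norm (G z)^2
      + 2 * kap * th * norm e^2 + (1/(4*t)) * norm d^2" .
  have "Q w + kap * norm (G w)^2 \<le> Q z + kap * norm (G z)^2 - kap * th * norm (G z)^2
     + (2 * t * norm e^2 + 2 * kap * th * norm e^2)" using Qd Gd2 by linarith
  also have "2 * t * norm e^2 + 2 * kap * th * norm e^2 = (2 + 2 * kap / lam) * t * norm e^2"
    by (simp add: th_def algebra_simps)
  finally show ?thesis unfolding w_def[symmetric] by (simp add: th_def)
qed

text \<open>The natural residual at \<open>P z\<close> is a difference of two proximal points, whose
  arguments \<open>z\<close> and P z - lam f'(P z) differ by lam times the normal map.\<close>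

lemma F_nat_le_F_nor: "norm (F_nat lam f' \<phi> (P z)) \<le> lam * norm (G z)"
proof -
  have "norm (F_nat lam f' \<phi> (P z)) \<le> norm (z - (P z - lam *\<^sub>R f' (P z)))"
    unfolding F_nat_def by (rule nonexp)
  also have "z - (P z - lam *\<^sub>R f' (P z)) = lam *\<^sub>R G z"
    using lam_pos by (simp add: F_nor_def algebra_simps)
  finally show ?thesis using lam_pos by simp
qed

end

section \<open>Perturbed paths and time windows\<close>

text \<open>Subtracting the partial sums of \<open>r\<close> leaves a decreasing sequence that is
  bounded below.\<close>

lemma almost_decreasing_convergent:
  fixes u g r :: "nat \<Rightarrow> real"
  assumes step: "\<And>k. u (Suc k) \<le> u k - g k + r k"
    and u: "\<And>k. 0 \<le> u k" and g: "\<And>k. 0 \<le> g k" and r: "\<And>k. 0 \<le> r k" and sr: "summable r"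
  shows "convergent u" "summable g"
proof -
  have part: "(\<Sum>j<k. r j) \<le> suminf r" for k using sr r by (intro sum_le_suminf) auto
  define w where "w k = u k - (\<Sum>j<k. r j)" for k
  have "w (Suc k) \<le> w k" for k using step[of k] g[of k] by (simp add: w_def)
  hence dec: "decseq w" by (rule decseq_SucI)
  have low: "- suminf r \<le> w k" for k using u[of k] part[of k] unfolding w_def by linarith
  obtain l where "w \<longlonglongrightarrow> l" using decseq_convergent[OF dec allI[OF low]] by blast
  hence "convergent w" by (auto simp: convergent_def)
  moreover have "convergent (\<lambda>k. \<Sum>j<k. r j)"
    using sr by (simp add: summable_iff_convergent)
  ultimately have "convergent (\<lambda>k. w k + (\<Sum>j<k. r j))" by (rule convergent_add)
  thus "convergent u" by (simp add: w_def)
  have sg: "(\<Sum>j<k. g j) \<le> u 0 + (\<Sum>j<k. r j) - u k" for k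
  proof (induction k)
    case (Suc k) thus ?case using step[of k] by simp
  qed simp
  have "(\<Sum>j<k. g j) \<le> u 0 + suminf r" for k using sg[of k] part[of k] u[of k] by linarith
  thus "summable g" using g by (intro summableI_nonneg_bounded[where x = "u 0 + suminf r"]) auto
qed

text \<open>A Gronwall product bounds 1 + h by a constant. The relative errors b (1 + h) then become
  summable absolute errors, and the preceding lemma applies.\<close>

lemma robbins_siegmund_deterministic:
  fixes h g b :: "nat \<Rightarrow> real"
  assumes step: "\<And>k. h (Suc k) \<le> h k - g k + b k * (1 + h k)"
    and h: "\<And>k. 0 \<le> h k" and g: "\<And>k. 0 \<le> g k" and b: "\<And>k. 0 \<le> b k" and sb: "summable b"
  shows "convergent h" "summable g" "\<exists>B. \<forall>k. h k \<le> B"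
proof -
  have bd: "1 + h k \<le> (1 + h 0) * exp (\<Sum>j<k. b j)" for k
  proof (induction k)
    case (Suc k)
    have "1 + h (Suc k) \<le> (1 + b k) * (1 + h k)" using step[of k] g[of k] by (simp add: algebra_simps)
    also have "\<dots> \<le> exp (b k) * ((1 + h 0) * exp (\<Sum>j<k. b j))"
      using Suc h b by (intro mult_mono) (auto simp: exp_ge_add_one_self)
    also have "\<dots> = (1 + h 0) * exp (\<Sum>j<Suc k. b j)" by (simp add: exp_add)
    finally show ?case .
  qed simp
  define B where "B = (1 + h 0) * exp (suminf b)"
  have B: "1 + h k \<le> B" for k
  proof -
    have "(\<Sum>j<k. b j) \<le> suminf b" using sb b by (intro sum_le_suminf) auto
    hence "(1 + h 0) * exp (\<Sum>j<k. b j) \<le> B"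
      unfolding B_def using h[of 0] by (intro mult_left_mono) auto
    thus ?thesis using bd[of k] by linarith
  qed
  have st: "h (Suc k) \<le> h k - g k + b k * B" for k
    using step[of k] mult_left_mono[OF B[of k] b[of k]] by linarith
  have B0: "0 \<le> B" using B[of 0] h[of 0] by linarith
  have s: "summable (\<lambda>k. b k * B)" using sb by (rule summable_mult2)
  show "convergent h" "summable g"
    using almost_decreasing_convergent[OF st h g _ s] b B0 by auto
  have "h k \<le> B" for k using B[of k] by linarith
  thus "\<exists>B. \<forall>k. h k \<le> B" by blast
qed

lemma strict_mono_bracket:
  fixes nn :: "nat \<Rightarrow> nat"
  assumes "strict_mono nn" "nn k0 \<le> i"
  shows "\<exists>k\<ge>k0. nn k \<le> i \<and> i < nn (Suc k)"
proof -
  have fin: "\<exists>k. i < nn k" using strict_mono_imp_increasing[OF assms(1), of "Suc i"] by (intro exI[of _ "Suc i"]) linarith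
  define m where "m = (LEAST k. i < nn k)"
  have m: "i < nn m" using LeastI_ex[OF fin] m_def by simp
  have "k0 < m" using assms m by (metis leD leI le_trans strict_mono_less_eq)
  then obtain k where k: "m = Suc k" "k0 \<le> k" by (metis Suc_le_D Suc_le_mono less_eq_Suc_le)
  have "\<not> i < nn k" using not_less_Least[of k "\<lambda>k. i < nn k"] k m_def by simp
  thus ?thesis using k m by auto
qed

lemma tendsto_from_windows:
  fixes s :: "nat \<Rightarrow> real"
  assumes nn: "strict_mono (nn :: nat \<Rightarrow> nat)"
    and near: "\<And>k i. nn k \<le> i \<Longrightarrow> i \<le> nn (Suc k) \<Longrightarrow> \<bar>s i - l\<bar> \<le> d k"
    and d: "d \<longlonglongrightarrow> 0"
  shows "s \<longlonglongrightarrow> l"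
proof (rule LIMSEQ_I)
  fix r :: real assume "0 < r"
  then obtain k0 where k0: "\<And>k. k \<ge> k0 \<Longrightarrow> norm (d k - 0) < r" using LIMSEQ_D[OF d] by blast
  have "norm (s i - l) < r" if i: "i \<ge> nn k0" for i
  proof -
    obtain k where k: "k \<ge> k0" "nn k \<le> i" "i < nn (Suc k)" using strict_mono_bracket[OF nn i] by blast
    have "\<bar>s i - l\<bar> \<le> d k" using near[of k i] k by simp
    thus ?thesis using k0[OF k(1)] by simp
  qed
  thus "\<exists>no. \<forall>n\<ge>no. norm (s n - l) < r" by blast
qed

text \<open>Greedy choice: once all step sizes are at most T/2, the first index at which the sum
  reaches T/2 overshoots by at most T/2. The late start \<open>n0\<close> is reserved for making the
  tail of the variance weights small.\<close>

lemma divergent_sum_windows: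
  fixes \<alpha> :: "nat \<Rightarrow> real"
  assumes pos: "\<And>k. \<alpha> k > 0" and div: "\<not> summable \<alpha>" and lim: "\<alpha> \<longlonglongrightarrow> 0" and T: "T > 0"
  obtains nn where "strict_mono nn" "nn 0 \<ge> n0"
    "\<And>k. T / 2 \<le> (\<Sum>j=nn k..<nn (Suc k). \<alpha> j)" "\<And>k. (\<Sum>j=nn k..<nn (Suc k). \<alpha> j) \<le> T"
proof -
  obtain n1 where n1: "\<And>n. n \<ge> n1 \<Longrightarrow> \<alpha> n \<le> T/2"
    using LIMSEQ_D[OF lim, of "T/2"] T pos by (auto simp: abs_of_pos intro: less_imp_le)
  have ex: "\<exists>m>n. T / 2 \<le> (\<Sum>j=n..<m. \<alpha> j) \<and> (\<Sum>j=n..<m. \<alpha> j) \<le> T" if n: "n \<ge> n1" for n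
  proof -
    have "\<exists>m. T/2 \<le> (\<Sum>j=n..<m. \<alpha> j)"
    proof (rule ccontr)
      assume "\<not> ?thesis"
      hence b: "(\<Sum>j=n..<m. \<alpha> j) \<le> T/2" for m by (simp add: not_le less_imp_le)
      have "(\<Sum>j<m. \<alpha> (j + n)) \<le> T/2" for m
        using b[of "m + n"] sum.shift_bounds_nat_ivl[of \<alpha> 0 n m] by (simp add: atLeast0LessThan)
      hence "summable (\<lambda>j. \<alpha> (j + n))"
        using pos by (intro summableI_nonneg_bounded[where x = "T/2"]) (auto intro: less_imp_le)
      thus False using div by simp
    qed
    define m where "m = (LEAST m. T/2 \<le> (\<Sum>j=n..<m. \<alpha> j))"
    have m: "T/2 \<le> (\<Sum>j=n..<m. \<alpha> j)" unfolding m_def by (rule LeastI_ex) fact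
    have nm: "n < m" using m T by (cases "n < m") auto
    then obtain p where p: "m = Suc p" "n \<le> p" by (cases m) auto
    have "\<not> T/2 \<le> (\<Sum>j=n..<p. \<alpha> j)"
      using not_less_Least[of p "\<lambda>m. T/2 \<le> (\<Sum>j=n..<m. \<alpha> j)"] p m_def by auto
    hence "(\<Sum>j=n..<m. \<alpha> j) \<le> T" using n1[of p] p n by simp
    thus ?thesis using m nm by blast
  qed
  then obtain nxt where nxt: "\<And>n. n \<ge> n1 \<Longrightarrow> nxt n > n \<and>
      T / 2 \<le> (\<Sum>j=n..<nxt n. \<alpha> j) \<and> (\<Sum>j=n..<nxt n. \<alpha> j) \<le> T" by metis
  define nn where "nn k = (nxt ^^ k) (max n0 n1)" for k
  have ge: "nn k \<ge> n1" for k
    by (induction k) (auto simp: nn_def dest: nxt intro: order_trans less_imp_le)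
  have "nn (Suc k) = nxt (nn k)" for k by (simp add: nn_def)
  thus ?thesis using nxt[OF ge] by (intro that[of nn]) (auto simp: strict_mono_Suc_iff nn_def[of 0])
qed

text \<open>All that the convergence proof retains from the proximal setting. The descent property
  quantifies over every \<open>e\<close>, which is what permits its use for whole windows.\<close>

locale merit_drift =
  fixes G :: "'a::euclidean_space \<Rightarrow> 'a" and Q :: "'a \<Rightarrow> real" and C qbar kap c D t0 :: real
  assumes C_pos: "C > 0" and kap_pos: "kap > 0" and c_pos: "c > 0" and D_pos: "D > 0"
    and t0_pos: "t0 > 0"
    and G_lip: "\<And>w z. norm (G w - G z) \<le> C * norm (w - z)"
    and Q_diff: "\<And>w z. \<bar>Q w - Q z\<bar> \<le> norm (G z) * norm (w - z) + C * norm (w - z)^2"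
    and Q_low: "\<And>z. qbar \<le> Q z"
    and descent: "\<And>t z e. 0 < t \<Longrightarrow> t \<le> t0 \<Longrightarrow>
       Q (z - t *\<^sub>R (G z + e)) + kap * norm (G (z - t *\<^sub>R (G z + e)))^2
    \<le> Q z + kap * norm (G z)^2 - c * t * norm (G z)^2 + D * t * norm e^2"
begin

definition H :: "'a \<Rightarrow> real" where "H z = Q z - qbar + kap * norm (G z)^2"

lemma H_nonneg: "0 \<le> H z" using Q_low[of z] kap_pos by (simp add: H_def)

lemma Q_le_H: "Q z - qbar \<le> H z" using kap_pos by (simp add: H_def)

lemma G_sq_le_H: "norm (G z)^2 \<le> H z / kap"
  using Q_low[of z] kap_pos by (simp add: H_def field_simps)

lemma G_sq_growth: "norm (G w)^2 \<le> 2 * norm (G z)^2 + 2 * C^2 * norm (w - z)^2"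
proof -
  have "norm (G w) \<le> norm (G z) + C * norm (w - z)"
    using G_lip[of w z] norm_triangle_ineq2[of "G w" "G z"] by linarith
  hence "norm (G w)^2 \<le> (norm (G z) + C * norm (w - z))^2" by (intro power_mono) auto
  also have "\<dots> \<le> 2 * norm (G z)^2 + 2 * (C * norm (w - z))^2"
    using zero_le_power2[of "norm (G z) - C * norm (w - z)"] by (simp add: power2_sum power2_diff)
  finally show ?thesis by (simp add: power_mult_distrib)
qed

lemma Q_diff_sq: "\<bar>Q w - Q z\<bar> \<le> norm (G z)^2 + (C + 1) * norm (w - z)^2"
proof -
  have "norm (G z) * norm (w - z) \<le> norm (G z)^2 + norm (w - z)^2"
    using sum_squares_bound[of "norm (G z)" "norm (w - z)"]
      mult_nonneg_nonneg[of "norm (G z)" "norm (w - z)", OF norm_ge_zero norm_ge_zero] by linarith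
  thus ?thesis using Q_diff[of w z] by (simp add: algebra_simps)
qed

definition C1 :: real where "C1 = 1 + (1 + 2 * kap) / kap + (C + 1 + 2 * kap * C^2)"

lemma C1_ge_1: "C1 \<ge> 1" using kap_pos C_pos by (simp add: C1_def add_nonneg_nonneg)

text \<open>Crude, but free of any step size restriction. It propagates integrability from one
  iterate to the next and controls the expected merit inside a window.\<close>

lemma H_growth: "H w \<le> C1 * (H z + norm (w - z)^2)"
proof -
  let ?n = "norm (w - z)^2"
  have "H w \<le> (Q z - qbar) + (norm (G z)^2 + (C + 1) * ?n) + kap * (2 * norm (G z)^2 + 2 * C^2 * ?n)"
    unfolding H_def using Q_diff_sq[of w z] mult_left_mono[OF G_sq_growth[of w z], of kap] kap_pos
    by linarith
  also have "\<dots> = (Q z - qbar) + (1 + 2 * kap) * norm (G z)^2 + (C + 1 + 2 * kap * C^2) * ?n"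
    by (simp add: algebra_simps)
  also have "\<dots> \<le> H z + (1 + 2 * kap) * (H z / kap) + (C + 1 + 2 * kap * C^2) * ?n"
    using Q_le_H[of z] mult_left_mono[OF G_sq_le_H[of z], of "1 + 2 * kap"] kap_pos by linarith
  also have "\<dots> = (1 + (1 + 2 * kap) / kap) * H z + (C + 1 + 2 * kap * C^2) * ?n"
    by (simp add: algebra_simps)
  also have "\<dots> \<le> C1 * H z + C1 * ?n"
  proof (intro add_mono mult_right_mono)
    have "0 \<le> (1 + 2 * kap) / kap" "0 \<le> C + 1 + 2 * kap * C^2" using kap_pos C_pos by auto
    thus "1 + (1 + 2 * kap) / kap \<le> C1" "C + 1 + 2 * kap * C^2 \<le> C1"
      unfolding C1_def by linarith+
  qed (use H_nonneg in auto)
  finally show ?thesis by (simp add: distrib_left)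
qed

lemma continuous_G: "continuous_on UNIV G"
proof -
  have "C-lipschitz_on UNIV G" using G_lip C_pos by (auto intro!: lipschitz_onI simp: dist_norm)
  thus ?thesis by (rule lipschitz_on_continuous_on)
qed

lemma continuous_Q: "continuous_on UNIV Q"
  unfolding continuous_on_def
proof
  fix z :: 'a
  have "((\<lambda>w. norm (G z) * norm (w - z) + C * norm (w - z)^2) \<longlongrightarrow>
      norm (G z) * norm (z - z) + C * norm (z - z)^2) (at z)"
    by (intro tendsto_intros)
  hence "((\<lambda>w. norm (G z) * norm (w - z) + C * norm (w - z)^2) \<longlongrightarrow> 0) (at z)" by simp
  hence "((\<lambda>w. Q w - Q z) \<longlongrightarrow> 0) (at z)"
    by (rule Lim_null_comparison[rotated]) (use Q_diff in auto)
  thus "(Q \<longlongrightarrow> Q z) (at z within UNIV)" by (simp add: LIM_zero_iff)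
qed

text \<open>Each bound has its purpose: 1 simplifies powers and total weights, \<open>t0\<close>
  admits the descent inequality, 1 / (2 C) allows absorption in the displacement estimate, and c /
  (16 D C^2) keeps the drift error below half the descent.\<close>

definition T :: real where "T = min (min 1 t0) (min (1 / (2 * C)) (c / (16 * D * C^2)))"

lemma T_pos: "T > 0" using t0_pos C_pos c_pos D_pos by (simp add: T_def)

lemma T_bounds: "T \<le> 1" "T \<le> t0" "2 * C * T \<le> 1" "16 * D * C^2 * T \<le> c"
proof -
  have "T \<le> 1 / (2 * C)" "T \<le> c / (16 * D * C^2)" by (auto simp: T_def)
  thus "2 * C * T \<le> 1" "16 * D * C^2 * T \<le> c" using C_pos D_pos by (auto simp: field_simps)
qed (auto simp: T_def)

lemma window_length_small: "t \<le> T \<Longrightarrow> 2 * C * t \<le> 1"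
  using T_bounds(3) C_pos mult_left_mono[of t T "2 * C"] by linarith

definition B :: real where "B = 8 + 2 * (2 * C + 1)^2"

lemma B_pos: "B > 0" by (simp add: B_def add_pos_nonneg)

end

section \<open>Pathwise estimates over one window\<close>

locale perturbed_path = merit_drift +
  fixes \<alpha> :: "nat \<Rightarrow> real" and z e :: "nat \<Rightarrow> 'a"
  assumes \<alpha>_nonneg: "\<And>k. \<alpha> k \<ge> 0"
    and z_step: "\<And>k. z (Suc k) = z k - \<alpha> k *\<^sub>R (G (z k) + e k)"
begin

definition noise :: "nat \<Rightarrow> nat \<Rightarrow> 'a" where "noise n i = (\<Sum>j=n..<i. \<alpha> j *\<^sub>R e j)"

text \<open>A weighted time average of the squared noise plus its final value, rather than a
  maximum: this is all the endpoint estimate uses, and its expectation follows from second moments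
  alone.\<close>

definition R :: "nat \<Rightarrow> nat \<Rightarrow> real" where
  "R n i = (\<Sum>j=n..<i. \<alpha> j * norm (noise n j)^2) + norm (noise n i)^2"

lemma R_nonneg: "0 \<le> R n i" unfolding R_def by (intro add_nonneg_nonneg sum_nonneg) (auto simp: \<alpha>_nonneg)

text \<open>The left side equals the sum of \<open>\<alpha> j *\<^sub>R (G (z n) - G (z j))\<close>:
  the error of freezing the vector field at the start of the window.\<close>

lemma displacement:
  assumes "n \<le> i"
  shows "norm (z i - z n + (\<Sum>j=n..<i. \<alpha> j) *\<^sub>R G (z n) + noise n i)
     \<le> C * (\<Sum>j=n..<i. \<alpha> j * norm (z j - z n))"
proof -
  have "z i - z n = - (\<Sum>j=n..<i. \<alpha> j *\<^sub>R G (z j)) - noise n i"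
    using assms
    by (induction i rule: dec_induct) (auto simp: noise_def z_step algebra_simps)
  hence "z i - z n + (\<Sum>j=n..<i. \<alpha> j) *\<^sub>R G (z n) + noise n i
      = (\<Sum>j=n..<i. \<alpha> j *\<^sub>R (G (z n) - G (z j)))"
    by (simp add: scaleR_sum_left sum_subtractf scaleR_diff_right)
  also have "norm \<dots> \<le> (\<Sum>j=n..<i. \<alpha> j * (C * norm (z j - z n)))"
    using G_lip \<alpha>_nonneg
    by (intro sum_norm_le) (auto simp: norm_minus_commute intro!: mult_left_mono)
  also have "\<dots> = C * (\<Sum>j=n..<i. \<alpha> j * norm (z j - z n))"
    by (simp add: sum_distrib_left mult_ac)
  finally show ?thesis .
qed

text \<open>Apart from noise, the error is quadratic in the window length. Its square divided by t
  is thus of order t^3 |G|^2, against a descent of order t |G|^2.\<close>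

lemma window_error:
  assumes ni: "n \<le> i" and t: "(\<Sum>j=n..<i. \<alpha> j) \<le> T"
  shows "norm (z i - z n + (\<Sum>j=n..<i. \<alpha> j) *\<^sub>R G (z n))
     \<le> 2 * C * (\<Sum>j=n..<i. \<alpha> j)^2 * norm (G (z n)) + (2 * C + 1) * sqrt (R n i)"
proof -
  define t where "t = (\<Sum>j=n..<i. \<alpha> j)"
  define W where "W i = (\<Sum>j=n..<i. \<alpha> j * norm (z j - z n))" for i
  define S where "S = (\<Sum>j=n..<i. \<alpha> j * norm (noise n j))"
  have t0: "0 \<le> t" "t \<le> T" "t \<le> 1" using t \<alpha>_nonneg T_bounds by (auto simp: t_def sum_nonneg)
  have W0: "0 \<le> W i" using \<alpha>_nonneg by (auto simp: W_def intro!: sum_nonneg)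
  have each: "norm (z j - z n) \<le> t * norm (G (z n)) + C * W i + norm (noise n j)"
    if j: "n \<le> j" "j < i" for j
  proof -
    let ?s = "\<Sum>l=n..<j. \<alpha> l"
    have "norm (z j - z n) \<le> norm (z j - z n + ?s *\<^sub>R G (z n) + noise n j) + norm (?s *\<^sub>R G (z n)) + norm (noise n j)"
      using norm_triangle_ineq4[of "z j - z n + ?s *\<^sub>R G (z n) + noise n j" "?s *\<^sub>R G (z n) + noise n j"]
        norm_triangle_ineq[of "?s *\<^sub>R G (z n)" "noise n j"] by (simp add: algebra_simps)
    also have "\<dots> \<le> C * W j + ?s * norm (G (z n)) + norm (noise n j)"
      using displacement[OF j(1)] \<alpha>_nonneg by (simp add: W_def sum_nonneg)
    \<comment> \<open>Enlarging to the common quantity \<open>W i\<close> makes the subsequent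
      summation close on a single unknown.\<close>
    also have "C * W j \<le> C * W i" unfolding W_def
      using C_pos j \<alpha>_nonneg by (intro mult_left_mono sum_mono2) auto
    also have "?s * norm (G (z n)) \<le> t * norm (G (z n))" unfolding t_def
      using j \<alpha>_nonneg by (intro mult_right_mono sum_mono2) auto
    finally show ?thesis by simp
  qed
  have "W i \<le> (\<Sum>j=n..<i. \<alpha> j * (t * norm (G (z n)) + C * W i + norm (noise n j)))"
    unfolding W_def[of i] using each \<alpha>_nonneg
    by (intro sum_mono mult_left_mono) (auto simp: W_def)
  also have "\<dots> = t^2 * norm (G (z n)) + C * t * W i + S"
    by (simp add: t_def S_def sum_distrib_right sum_distrib_left distrib_left sum.distrib power2_eq_square mult_ac)
  \<comment> \<open>\<open>W i\<close> bounds itself with factor C t, at most 1/2 by the choice of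
    \<open>T\<close>, so that term can be absorbed on the left.\<close>
  finally have W1: "W i \<le> t^2 * norm (G (z n)) + (C * t) * W i + S" .
  have "C * t \<le> 1/2" using window_length_small[OF t0(2)] by simp
  hence "(C * t) * W i \<le> (1/2) * W i" using W0 by (intro mult_right_mono) auto
  hence W2: "W i \<le> 2 * t^2 * norm (G (z n)) + 2 * S" using W1 by simp
  have "S^2 \<le> t * (\<Sum>j=n..<i. \<alpha> j * norm (noise n j)^2)"
  proof -
    \<comment> \<open>Splitting each weight into square roots lets Cauchy-Schwarz separate the total
      length from the first part of \<open>R\<close>.\<close>
    have "S = (\<Sum>j=n..<i. sqrt (\<alpha> j) * (sqrt (\<alpha> j) * norm (noise n j)))"
      using \<alpha>_nonneg by (simp add: S_def mult.assoc[symmetric])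
    hence "S^2 \<le> (\<Sum>j=n..<i. (sqrt (\<alpha> j))^2) * (\<Sum>j=n..<i. (sqrt (\<alpha> j) * norm (noise n j))^2)"
      by (simp add: Cauchy_Schwarz_ineq_sum)
    thus ?thesis using \<alpha>_nonneg by (simp add: t_def power_mult_distrib)
  qed
  also have "\<dots> \<le> (\<Sum>j=n..<i. \<alpha> j * norm (noise n j)^2)"
    using t0 \<alpha>_nonneg by (intro mult_left_le_one_le) (auto intro!: sum_nonneg)
  also have "\<dots> \<le> R n i" by (simp add: R_def)
  finally have S: "S \<le> sqrt (R n i)" by (rule real_le_rsqrt)
  have "norm (noise n i)^2 \<le> R n i" using \<alpha>_nonneg by (auto simp: R_def intro!: sum_nonneg)
  hence N: "norm (noise n i) \<le> sqrt (R n i)" by (rule real_le_rsqrt)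
  have "norm (z i - z n + t *\<^sub>R G (z n)) \<le> norm (z i - z n + t *\<^sub>R G (z n) + noise n i) + norm (noise n i)"
    using norm_triangle_ineq4[of "z i - z n + t *\<^sub>R G (z n) + noise n i" "noise n i"] by simp
  also have "\<dots> \<le> C * W i + sqrt (R n i)"
    using displacement[OF ni] N by (simp add: W_def t_def)
  also have "C * W i \<le> C * (2 * t^2 * norm (G (z n)) + 2 * sqrt (R n i))"
    using C_pos W2 S by (intro mult_left_mono) auto
  finally show ?thesis by (simp add: t_def algebra_simps)
qed

lemma window_error_sq:
  assumes ni: "n \<le> i" and t: "(\<Sum>j=n..<i. \<alpha> j) \<le> T"
  shows "norm (z i - z n + (\<Sum>j=n..<i. \<alpha> j) *\<^sub>R G (z n))^2
     \<le> 8 * C^2 * (\<Sum>j=n..<i. \<alpha> j)^4 * norm (G (z n))^2 + 2 * (2 * C + 1)^2 * R n i"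
proof -
  let ?a = "2 * C * (\<Sum>j=n..<i. \<alpha> j)^2 * norm (G (z n))" and ?b = "(2 * C + 1) * sqrt (R n i)"
  have "norm (z i - z n + (\<Sum>j=n..<i. \<alpha> j) *\<^sub>R G (z n))^2 \<le> (?a + ?b)^2"
    using window_error[OF assms] by (intro power_mono) auto
  also have "\<dots> \<le> 2 * ?a^2 + 2 * ?b^2"
    using zero_le_power2[of "?a - ?b"] by (simp add: power2_sum power2_diff)
  finally show ?thesis using R_nonneg[of n i] by (simp add: power_mult_distrib)
qed

text \<open>Has no lower bound on the elapsed length, so it applies to every index inside a
  window.\<close>

lemma window_displacement_sq:
  assumes ni: "n \<le> i" and t: "(\<Sum>j=n..<i. \<alpha> j) \<le> T"
  shows "norm (z i - z n)^2 \<le> B * (norm (G (z n))^2 + R n i)"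
proof -
  define t where "t = (\<Sum>j=n..<i. \<alpha> j)"
  have t0: "0 \<le> t" "t \<le> T" "t \<le> 1" using t \<alpha>_nonneg T_bounds by (auto simp: t_def sum_nonneg)
  have "(2 * C * t) * t \<le> 1 * 1"
    using window_length_small[OF t0(2)] t0 C_pos by (intro mult_mono) auto
  hence "2 * C * t^2 * norm (G (z n)) \<le> 1 * norm (G (z n))"
    by (intro mult_right_mono) (auto simp: power2_eq_square)
  moreover have "norm (z i - z n) \<le> norm (z i - z n + t *\<^sub>R G (z n)) + t * norm (G (z n))"
    using norm_triangle_ineq4[of "z i - z n + t *\<^sub>R G (z n)" "t *\<^sub>R G (z n)"] t0 by simp
  moreover have "t * norm (G (z n)) \<le> 1 * norm (G (z n))" using t0 by (intro mult_right_mono) auto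
  ultimately have "norm (z i - z n) \<le> 2 * norm (G (z n)) + (2 * C + 1) * sqrt (R n i)" (is "_ \<le> ?a + ?b")
    using window_error[OF assms] by (simp add: t_def)
  hence "norm (z i - z n)^2 \<le> (?a + ?b)^2" by (intro power_mono) auto
  also have "\<dots> \<le> 2 * ?a^2 + 2 * ?b^2"
    using zero_le_power2[of "?a - ?b"] by (simp add: power2_sum power2_diff)
  also have "\<dots> = 8 * norm (G (z n))^2 + 2 * (2 * C + 1)^2 * R n i"
    using R_nonneg[of n i] by (simp add: power_mult_distrib)
  also have "\<dots> \<le> B * norm (G (z n))^2 + B * R n i"
    unfolding B_def using R_nonneg by (intro add_mono mult_right_mono) auto
  finally show ?thesis by (simp add: distrib_left)
qed

text \<open>The whole window acts as a single step of length at most \<open>T\<close>; resetting the noise at the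
  start of each window is what makes the error summable.\<close>

lemma window_descent:
  assumes ni: "n \<le> i" and t: "T / 2 \<le> (\<Sum>j=n..<i. \<alpha> j)" "(\<Sum>j=n..<i. \<alpha> j) \<le> T"
  shows "H (z i) \<le> H (z n) - (c * T / 4) * norm (G (z n))^2 + (4 * D * (2 * C + 1)^2 / T) * R n i"
proof -
  define t where "t = (\<Sum>j=n..<i. \<alpha> j)"
  have t0: "T / 2 \<le> t" "t \<le> T" "t \<le> 1" "0 < t" "t \<le> t0"
    using t T_bounds T_pos by (auto simp: t_def)
  \<comment> \<open>Defined by solving the one-step formula: the window becomes exactly one step of
    length t with error \<open>u\<close>.\<close>
  define u where "u = - (1/t) *\<^sub>R (z i - z n) - G (z n)"
  have zi: "z i = z n - t *\<^sub>R (G (z n) + u)" using t0 by (simp add: u_def)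
  have "t *\<^sub>R u = - (z i - z n + t *\<^sub>R G (z n))" using t0 by (simp add: u_def algebra_simps)
  hence tu: "norm (t *\<^sub>R u)^2 \<le> 8 * C^2 * t^4 * norm (G (z n))^2 + 2 * (2 * C + 1)^2 * R n i"
    using window_error_sq[OF ni t(2)] by (simp only: norm_minus_cancel t_def)
  have "D * t * norm u^2 = (D / t) * norm (t *\<^sub>R u)^2"
    using t0 by (simp add: power_mult_distrib power2_eq_square)
  also have "\<dots> \<le> (D / t) * (8 * C^2 * t^4 * norm (G (z n))^2 + 2 * (2 * C + 1)^2 * R n i)"
    using tu t0 D_pos by (intro mult_left_mono) auto
  also have "\<dots> = (8 * D * C^2 * t^2) * t * norm (G (z n))^2 + (2 * D * (2 * C + 1)^2 * R n i) / t"
    using t0 by (simp add: field_simps power_numeral_reduce)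
  also have "(8 * D * C^2 * t^2) * t * norm (G (z n))^2 \<le> (c / 2) * t * norm (G (z n))^2"
  proof (intro mult_right_mono)
    have "t^2 \<le> T" using t0 T_pos mult_mono[of t T t 1] by (simp add: power2_eq_square)
    hence "(8 * D * C^2) * t^2 \<le> (8 * D * C^2) * T" using D_pos by (intro mult_left_mono) auto
    thus "8 * D * C^2 * t^2 \<le> c / 2" using T_bounds(4) by simp
  qed (use t0 in auto)
  \<comment> \<open>The only use of the lower bound T/2 on the noise side: it keeps the factor 1/t
    uniformly bounded.\<close>
  also have "(2 * D * (2 * C + 1)^2 * R n i) / t \<le> (2 * D * (2 * C + 1)^2 * R n i) / (T / 2)"
    using t0 T_pos D_pos R_nonneg by (intro divide_left_mono) auto
  finally have Du: "D * t * norm u^2 \<le> (c / 2) * t * norm (G (z n))^2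
      + (4 * D * (2 * C + 1)^2 / T) * R n i" by (simp add: field_simps)
  have "H (z i) \<le> H (z n) - c * t * norm (G (z n))^2 + D * t * norm u^2"
    using descent[OF t0(4,5), of "z n" u] unfolding zi[symmetric] H_def by simp
  moreover have "(c * T / 4) * norm (G (z n))^2 \<le> (c / 2) * t * norm (G (z n))^2"
    using t0 c_pos by (intro mult_right_mono) (auto simp: field_simps)
  ultimately show ?thesis using Du by linarith
qed

text \<open>Summability of \<open>R\<close> settles the window endpoints; the uniform smallness of
  the noise is used only in between. The latter is phrased with 1 / (p + 1) so that almost sure
  validity involves countably many events.\<close>

lemma window_path_limits:
  assumes nn: "strict_mono nn"
    and t: "\<And>k. T / 2 \<le> (\<Sum>j=nn k..<nn (Suc k). \<alpha> j)" "\<And>k. (\<Sum>j=nn k..<nn (Suc k). \<alpha> j) \<le> T"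
    and sR: "summable (\<lambda>k. R (nn k) (nn (Suc k)))"
    and max0: "\<And>p. \<forall>\<^sub>F k in sequentially. \<forall>i\<in>{nn k..nn (Suc k)}. norm (noise (nn k) i) < 1 / real (Suc p)"
  shows "(\<lambda>i. norm (G (z i))) \<longlonglongrightarrow> 0" "convergent (\<lambda>i. Q (z i))"
proof -
  define r where "r k = R (nn k) (nn (Suc k))" for k
  have mono: "nn k \<le> nn (Suc k)" for k using nn by (simp add: strict_mono_less_eq)
  define E where "E = 4 * D * (2 * C + 1)^2 / T"
  have E: "E \<ge> 0" using D_pos T_pos by (simp add: E_def)
  have desc: "H (z (nn (Suc k))) \<le> H (z (nn k)) - (c * T / 4) * norm (G (z (nn k)))^2 + E * r k" for k
    unfolding r_def E_def by (rule window_descent[OF mono t])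
  have sEr: "summable (\<lambda>k. E * r k)" using sR unfolding r_def by (rule summable_mult)
  have Hconv: "convergent (\<lambda>k. H (z (nn k)))" and sG: "summable (\<lambda>k. (c * T / 4) * norm (G (z (nn k)))^2)"
    using almost_decreasing_convergent[where u = "\<lambda>k. H (z (nn k))", OF desc H_nonneg _ _ sEr]
      c_pos T_pos E R_nonneg by (auto simp: r_def)
  have "(\<lambda>k. (4 / (c * T)) * ((c * T / 4) * norm (G (z (nn k)))^2)) \<longlonglongrightarrow> (4 / (c * T)) * 0"
    by (intro tendsto_intros summable_LIMSEQ_zero sG)
  hence G0: "(\<lambda>k. norm (G (z (nn k)))^2) \<longlonglongrightarrow> 0" using c_pos T_pos by simp
  have r0: "r \<longlonglongrightarrow> 0" using summable_LIMSEQ_zero[OF sR] unfolding r_def .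
  define mx where "mx k = Max ((\<lambda>i. norm (noise (nn k) i)) ` {nn k..nn (Suc k)})" for k
  have mx: "norm (noise (nn k) i) \<le> mx k" if "nn k \<le> i" "i \<le> nn (Suc k)" for k i
    unfolding mx_def using that by (intro Max_ge) auto
  have mx_nonneg: "0 \<le> mx k" for k using mx[of k "nn k"] mono[of k] norm_ge_zero order_trans by blast
  have "mx \<longlonglongrightarrow> 0"
  proof (rule LIMSEQ_I)
    fix s :: real assume "0 < s"
    then obtain p where p: "1 / real (Suc p) < s" using nat_approx_posE by blast
    have "\<forall>\<^sub>F k in sequentially. norm (mx k - 0) < s"
      using max0[of p]
    proof eventually_elim
      case (elim k)
      hence "mx k < 1 / real (Suc p)" unfolding mx_def using mono[of k] by (subst Max_less_iff) auto
      thus ?case using p mx_nonneg[of k] by simp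
    qed
    thus "\<exists>no. \<forall>n\<ge>no. norm (mx n - 0) < s" by (simp add: eventually_sequentially)
  qed
  \<comment> \<open>The time average in \<open>R\<close> is monotone in the end index, but the final
    squared noise is not; the window maximum \<open>mx k\<close> covers it.\<close>
  have Rle: "R (nn k) i \<le> r k + mx k^2" if "nn k \<le> i" "i \<le> nn (Suc k)" for k i
  proof -
    have "(\<Sum>j=nn k..<i. \<alpha> j * norm (noise (nn k) j)^2) \<le> (\<Sum>j=nn k..<nn (Suc k). \<alpha> j * norm (noise (nn k) j)^2)"
      using that \<alpha>_nonneg by (intro sum_mono2) auto
    also have "\<dots> \<le> r k" by (simp add: r_def R_def)
    finally show ?thesis using mx[OF that] unfolding R_def by (intro add_mono power_mono) auto
  qed
  define d where "d k = B * (norm (G (z (nn k)))^2 + (r k + mx k^2))" for k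
  have "d \<longlonglongrightarrow> B * (0 + (0 + 0^2))" unfolding d_def by (intro tendsto_intros G0 r0 \<open>mx \<longlonglongrightarrow> 0\<close>)
  hence d0: "d \<longlonglongrightarrow> 0" by simp
  have disp: "norm (z i - z (nn k))^2 \<le> d k" if "nn k \<le> i" "i \<le> nn (Suc k)" for k i
  proof -
    have "(\<Sum>j=nn k..<i. \<alpha> j) \<le> (\<Sum>j=nn k..<nn (Suc k). \<alpha> j)"
      using that \<alpha>_nonneg by (intro sum_mono2) auto
    hence "norm (z i - z (nn k))^2 \<le> B * (norm (G (z (nn k)))^2 + R (nn k) i)"
      using t(2)[of k] by (intro window_displacement_sq that) auto
    also have "\<dots> \<le> d k" unfolding d_def using Rle[OF that] B_pos by (intro mult_left_mono) auto
    finally show ?thesis .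
  qed
  have "(\<lambda>i. norm (G (z i))^2) \<longlonglongrightarrow> 0"
  proof (rule tendsto_from_windows[OF nn])
    fix k i assume ki: "nn k \<le> i" "i \<le> nn (Suc k)"
    have "norm (G (z i))^2 \<le> 2 * norm (G (z (nn k)))^2 + 2 * C^2 * norm (z i - z (nn k))^2"
      by (rule G_sq_growth)
    also have "\<dots> \<le> 2 * norm (G (z (nn k)))^2 + 2 * C^2 * d k"
      using disp[OF ki] by (intro add_mono mult_left_mono) auto
    finally show "\<bar>norm (G (z i))^2 - 0\<bar> \<le> 2 * norm (G (z (nn k)))^2 + 2 * C^2 * d k" by simp
  next
    have "(\<lambda>k. 2 * norm (G (z (nn k)))^2 + 2 * C^2 * d k) \<longlonglongrightarrow> 2 * 0 + 2 * C^2 * 0"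
      by (intro tendsto_intros G0 d0)
    thus "(\<lambda>k. 2 * norm (G (z (nn k)))^2 + 2 * C^2 * d k) \<longlonglongrightarrow> 0" by simp
  qed
  from tendsto_real_sqrt[OF this] show "(\<lambda>i. norm (G (z i))) \<longlonglongrightarrow> 0" by simp
  obtain l where l: "(\<lambda>k. H (z (nn k))) \<longlonglongrightarrow> l" using Hconv by (auto simp: convergent_def)
  have "(\<lambda>k. H (z (nn k)) + qbar - kap * norm (G (z (nn k)))^2) \<longlonglongrightarrow> l + qbar - kap * 0"
    by (intro tendsto_intros l G0)
  hence Ql: "(\<lambda>k. Q (z (nn k))) \<longlonglongrightarrow> l + qbar" by (simp add: H_def)
  have "(\<lambda>i. Q (z i)) \<longlonglongrightarrow> l + qbar"
  proof (rule tendsto_from_windows[OF nn])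
    fix k i assume ki: "nn k \<le> i" "i \<le> nn (Suc k)"
    have "\<bar>Q (z i) - Q (z (nn k))\<bar> \<le> norm (G (z (nn k)))^2 + (C + 1) * norm (z i - z (nn k))^2"
      by (rule Q_diff_sq)
    also have "\<dots> \<le> norm (G (z (nn k)))^2 + (C + 1) * d k"
      using disp[OF ki] C_pos by (intro add_mono mult_left_mono) auto
    finally show "\<bar>Q (z i) - (l + qbar)\<bar> \<le> \<bar>Q (z (nn k)) - (l + qbar)\<bar> + (norm (G (z (nn k)))^2 + (C + 1) * d k)"
      by linarith
  next
    have "(\<lambda>k. \<bar>Q (z (nn k)) - (l + qbar)\<bar> + (norm (G (z (nn k)))^2 + (C + 1) * d k)) \<longlonglongrightarrow> \<bar>(l + qbar) - (l + qbar)\<bar> + (0 + (C + 1) * 0)"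
      by (intro tendsto_intros G0 d0 Ql)
    thus "(\<lambda>k. \<bar>Q (z (nn k)) - (l + qbar)\<bar> + (norm (G (z (nn k)))^2 + (C + 1) * d k)) \<longlonglongrightarrow> 0" by simp
  qed
  thus "convergent (\<lambda>i. Q (z i))" by (auto simp: convergent_def)
qed

end

section \<open>Stochastic perturbations\<close>

lemma (in finite_measure) integrable_of_square_integrable:
  fixes X :: "'a \<Rightarrow> 'b::euclidean_space"
  assumes [measurable]: "X \<in> borel_measurable M" and "integrable M (\<lambda>\<omega>. norm (X \<omega>)^2)"
  shows "integrable M X"
proof (rule Bochner_Integration.integrable_bound)
  show "integrable M (\<lambda>\<omega>. 1 + norm (X \<omega>)^2)" using assms by simp
  have "norm x \<le> 1 + norm x^2" for x :: 'b
    using sum_squares_bound[of 1 "norm x"] norm_ge_zero[of x] by (simp only: mult_1_right power_one)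
  thus "AE \<omega> in M. norm (X \<omega>) \<le> norm (1 + norm (X \<omega>)^2)" by simp
qed simp

lemma integrable_inner_square_integrable:
  fixes X Y :: "'a \<Rightarrow> 'b::euclidean_space"
  assumes [measurable]: "X \<in> borel_measurable M" "Y \<in> borel_measurable M"
    and "integrable M (\<lambda>\<omega>. norm (X \<omega>)^2)" "integrable M (\<lambda>\<omega>. norm (Y \<omega>)^2)"
  shows "integrable M (\<lambda>\<omega>. X \<omega> \<bullet> Y \<omega>)"
proof (rule Bochner_Integration.integrable_bound)
  show "integrable M (\<lambda>\<omega>. norm (X \<omega>)^2 + norm (Y \<omega>)^2)" using assms by simp
  have "\<bar>x \<bullet> y\<bar> \<le> norm x^2 + norm y^2" for x y :: 'b
    using Cauchy_Schwarz_ineq2[of x y] sum_squares_bound[of "norm x" "norm y"]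
      mult_nonneg_nonneg[of "norm x" "norm y", OF norm_ge_zero norm_ge_zero] by linarith
  thus "AE \<omega> in M. norm (X \<omega> \<bullet> Y \<omega>) \<le> norm (norm (X \<omega>)^2 + norm (Y \<omega>)^2)" by simp
qed simp

lemma norm_sq_add: "norm (x + y :: 'b::euclidean_space)^2 = norm x^2 + 2 * (x \<bullet> y) + norm y^2"
  by (simp add: power2_norm_eq_inner inner_add_left inner_add_right inner_commute)

lemma summable_window_sums:
  fixes a :: "nat \<Rightarrow> real"
  assumes "summable a" "\<And>k. 0 \<le> a k" "mono nn"
  shows "summable (\<lambda>k. \<Sum>j=nn k..<nn (Suc k). a j)"
proof (rule summableI_nonneg_bounded)
  show "0 \<le> (\<Sum>j=nn k..<nn (Suc k). a j)" for k by (intro sum_nonneg assms)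
  fix K
  have "(\<Sum>k<K. \<Sum>j=nn k..<nn (Suc k). a j) = (\<Sum>j=nn 0..<nn K. a j)"
  proof (induction K)
    case (Suc K)
    have "nn 0 \<le> nn K" "nn K \<le> nn (Suc K)" using assms(3) by (auto intro: monoD)
    thus ?case using Suc by (simp add: sum.atLeastLessThan_concat)
  qed simp
  also have "\<dots> \<le> suminf a" using assms by (intro sum_le_suminf) auto
  finally show "(\<Sum>k<K. \<Sum>j=nn k..<nn (Suc k). a j) \<le> suminf a" .
qed

text \<open>Unbiasedness is required only under integrability of the error, because integrability of
  the iterates is itself a consequence, obtained by induction along the method.\<close>

locale stochastic_drift = merit_drift G Q C qbar kap c D t0 + prob_space M
  for G :: "'a::euclidean_space \<Rightarrow> 'a" and Q :: "'a \<Rightarrow> real" and C qbar kap c D t0 :: real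
    and M :: "'w measure" +
  fixes F :: "nat \<Rightarrow> 'w measure" and \<alpha> :: "nat \<Rightarrow> real" and z0 :: 'a
    and z e :: "nat \<Rightarrow> 'w \<Rightarrow> 'a" and A :: real and \<sigma> :: "nat \<Rightarrow> real"
  assumes filt: "filtration (space M) F" and subalg: "\<And>k. subalgebra M (F k)"
    and alpha_pos: "\<And>k. \<alpha> k > 0" and alpha_div: "\<not> summable \<alpha>" and alpha_lim: "\<alpha> \<longlonglongrightarrow> 0"
    and z_0: "\<And>\<omega>. z 0 \<omega> = z0"
    and z_Suc: "\<And>k \<omega>. z (Suc k) \<omega> = z k \<omega> - \<alpha> k *\<^sub>R (G (z k \<omega>) + e k \<omega>)"
    and z_meas: "\<And>k. z k \<in> borel_measurable (F k)"
    and e_meas: "\<And>k. e k \<in> borel_measurable (F (Suc k))"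
    and A_nonneg: "A \<ge> 0"
    and e_unbiased: "\<And>k b. b \<in> Basis \<Longrightarrow> integrable M (e k) \<Longrightarrow>
        AE \<omega> in M. real_cond_exp M (F k) (\<lambda>\<omega>. e k \<omega> \<bullet> b) \<omega> = 0"
    and e_var: "\<And>k. AE \<omega> in M. nn_cond_exp M (F k) (\<lambda>\<omega>. ennreal (norm (e k \<omega>)^2)) \<omega>
          \<le> ennreal ((\<sigma> k)^2 + A * (Q (z k \<omega>) - qbar))"
    and step_sum: "summable (\<lambda>k. (\<alpha> k)^2 * max A ((\<sigma> k)^2))"
begin

text \<open>Freezing \<omega> makes all pathwise estimates available, with \<omega> as an extra
  argument.\<close>

sublocale path: perturbed_path G Q C qbar kap c D t0 \<alpha> "\<lambda>k. z k \<omega>" "\<lambda>k. e k \<omega>" for \<omega>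
  by unfold_locales (use alpha_pos z_Suc in \<open>auto intro: less_imp_le\<close>)

section \<open>Measurability and integrability along the iterates\<close>

lemma meas_mono: "i \<le> j \<Longrightarrow> X \<in> borel_measurable (F i) \<Longrightarrow> X \<in> borel_measurable (F j)"
  using filt unfolding filtration_def
  by (intro measurable_from_subalg[of "F j" "F i"]) (auto simp: subalgebra_def)

lemma meas_F_M: "X \<in> borel_measurable (F i) \<Longrightarrow> X \<in> borel_measurable M"
  using subalg by (rule measurable_from_subalg)

lemma sfs: "sigma_finite_subalgebra M (F k)"
  using subalg finite_measure_axioms
  by (intro finite_measure_subalgebra_is_sigma_finite) (simp add: finite_measure_subalgebra_def finite_measure_subalgebra_axioms_def)

lemma z_meas_M [measurable]: "z k \<in> borel_measurable M" by (rule meas_F_M[OF z_meas])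
lemma e_meas_M [measurable]: "e k \<in> borel_measurable M" by (rule meas_F_M[OF e_meas])

lemma G_borel [measurable]: "G \<in> borel_measurable borel"
  by (rule borel_measurable_continuous_onI[OF continuous_G])

lemma Q_borel [measurable]: "Q \<in> borel_measurable borel"
  by (rule borel_measurable_continuous_onI[OF continuous_Q])

lemma H_borel [measurable]: "H \<in> borel_measurable borel" unfolding H_def by measurable

lemma e_square_integrable_step:
  assumes "integrable M (\<lambda>\<omega>. H (z k \<omega>))"
  shows "integrable M (\<lambda>\<omega>. norm (e k \<omega>)^2)"
    "(\<integral>\<omega>. norm (e k \<omega>)^2 \<partial>M) \<le> (\<sigma> k)^2 + A * (\<integral>\<omega>. H (z k \<omega>) \<partial>M)"
proof -
  interpret sigma_finite_subalgebra M "F k" by (rule sfs)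
  have i: "integrable M (\<lambda>\<omega>. (\<sigma> k)^2 + A * H (z k \<omega>))" using assms by simp
  \<comment> \<open>The factor 1 is the test function in the defining identity of the conditional
    expectation. Nonnegative integrals are used so that integrability comes out as a result.\<close>
  have "(\<integral>\<^sup>+ \<omega>. ennreal (norm (e k \<omega>)^2) \<partial>M)
      = (\<integral>\<^sup>+ \<omega>. 1 * nn_cond_exp M (F k) (\<lambda>\<omega>. ennreal (norm (e k \<omega>)^2)) \<omega> \<partial>M)"
    by (subst nn_cond_exp_intg) auto
  also have "\<dots> \<le> (\<integral>\<^sup>+ \<omega>. ennreal ((\<sigma> k)^2 + A * H (z k \<omega>)) \<partial>M)"
  proof (rule nn_integral_mono_AE)
    show "AE \<omega> in M. 1 * nn_cond_exp M (F k) (\<lambda>\<omega>. ennreal (norm (e k \<omega>)^2)) \<omega>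
        \<le> ennreal ((\<sigma> k)^2 + A * H (z k \<omega>))"
      using e_var[of k]
    proof eventually_elim
      case (elim \<omega>)
      have "A * (Q (z k \<omega>) - qbar) \<le> A * H (z k \<omega>)" by (intro mult_left_mono Q_le_H A_nonneg)
      hence "ennreal ((\<sigma> k)^2 + A * (Q (z k \<omega>) - qbar)) \<le> ennreal ((\<sigma> k)^2 + A * H (z k \<omega>))"
        by (intro ennreal_leI) simp
      thus ?case using elim by simp
    qed
  qed
  also have "\<dots> = ennreal (\<integral>\<omega>. (\<sigma> k)^2 + A * H (z k \<omega>) \<partial>M)"
    using A_nonneg H_nonneg by (intro nn_integral_eq_integral i) auto
  also have "(\<integral>\<omega>. (\<sigma> k)^2 + A * H (z k \<omega>) \<partial>M) = (\<sigma> k)^2 + A * (\<integral>\<omega>. H (z k \<omega>) \<partial>M)"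
    using assms by (simp add: prob_space)
  finally have le: "(\<integral>\<^sup>+ \<omega>. ennreal (norm (e k \<omega>)^2) \<partial>M) \<le> ennreal ((\<sigma> k)^2 + A * (\<integral>\<omega>. H (z k \<omega>) \<partial>M))" .
  show int: "integrable M (\<lambda>\<omega>. norm (e k \<omega>)^2)"
    using le by (intro integrableI_bounded) (auto simp: less_top[symmetric] top_unique)
  have "0 \<le> (\<sigma> k)^2 + A * (\<integral>\<omega>. H (z k \<omega>) \<partial>M)"
    using A_nonneg H_nonneg by (intro add_nonneg_nonneg mult_nonneg_nonneg integral_nonneg_AE) auto
  moreover have "ennreal (\<integral>\<omega>. norm (e k \<omega>)^2 \<partial>M) \<le> ennreal ((\<sigma> k)^2 + A * (\<integral>\<omega>. H (z k \<omega>) \<partial>M))"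
    using le by (subst nn_integral_eq_integral[OF int, symmetric]) auto
  ultimately show "(\<integral>\<omega>. norm (e k \<omega>)^2 \<partial>M) \<le> (\<sigma> k)^2 + A * (\<integral>\<omega>. H (z k \<omega>) \<partial>M)" by simp
qed

text \<open>Integrable merit bounds the second moment of the current error, and that in turn bounds
  the next merit by \<open>H_growth\<close>; the deterministic start anchors the induction.\<close>

lemma H_integrable: "integrable M (\<lambda>\<omega>. H (z k \<omega>))"
proof (induction k)
  case 0 show ?case by (simp add: z_0)
next
  case (Suc k)
  note ie = e_square_integrable_step(1)[OF Suc]
  have iG: "integrable M (\<lambda>\<omega>. norm (G (z k \<omega>))^2)"
    by (rule Bochner_Integration.integrable_bound[where f = "\<lambda>\<omega>. H (z k \<omega>) / kap"])
      (use Suc G_sq_le_H H_nonneg kap_pos in \<open>auto simp: abs_of_nonneg\<close>)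
  show ?case
  proof (rule Bochner_Integration.integrable_bound)
    show "integrable M (\<lambda>\<omega>. C1 * (H (z k \<omega>) + (\<alpha> k)^2 * (2 * norm (G (z k \<omega>))^2 + 2 * norm (e k \<omega>)^2)))"
      using Suc ie iG by simp
    show "AE \<omega> in M. norm (H (z (Suc k) \<omega>))
        \<le> norm (C1 * (H (z k \<omega>) + (\<alpha> k)^2 * (2 * norm (G (z k \<omega>))^2 + 2 * norm (e k \<omega>)^2)))"
    proof (rule AE_I2)
      fix \<omega>
      let ?g = "G (z k \<omega>)" and ?e = "e k \<omega>"
      have "norm (?g + ?e)^2 \<le> (norm ?g + norm ?e)^2" by (intro power_mono norm_triangle_ineq) simp
      also have "\<dots> \<le> 2 * norm ?g^2 + 2 * norm ?e^2"
        using zero_le_power2[of "norm ?g - norm ?e"] by (simp add: power2_sum power2_diff)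
      finally have "(\<alpha> k)^2 * norm (?g + ?e)^2 \<le> (\<alpha> k)^2 * (2 * norm ?g^2 + 2 * norm ?e^2)"
        by (intro mult_left_mono) auto
      moreover have "norm (z (Suc k) \<omega> - z k \<omega>)^2 = (\<alpha> k)^2 * norm (?g + ?e)^2"
        by (simp add: z_Suc power_mult_distrib)
      ultimately have "C1 * (H (z k \<omega>) + norm (z (Suc k) \<omega> - z k \<omega>)^2)
          \<le> C1 * (H (z k \<omega>) + (\<alpha> k)^2 * (2 * norm ?g^2 + 2 * norm ?e^2))"
        using C1_ge_1 by (intro mult_left_mono) auto
      hence "H (z (Suc k) \<omega>) \<le> C1 * (H (z k \<omega>) + (\<alpha> k)^2 * (2 * norm ?g^2 + 2 * norm ?e^2))"
        using H_growth[of "z (Suc k) \<omega>" "z k \<omega>"] by linarith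
      thus "norm (H (z (Suc k) \<omega>)) \<le> norm (C1 * (H (z k \<omega>) + (\<alpha> k)^2 * (2 * norm ?g^2 + 2 * norm ?e^2)))"
        using H_nonneg[of "z (Suc k) \<omega>"] by simp
    qed
  qed measurable
qed

lemma G_sq_integrable: "integrable M (\<lambda>\<omega>. norm (G (z k \<omega>))^2)"
  by (rule Bochner_Integration.integrable_bound[where f = "\<lambda>\<omega>. H (z k \<omega>) / kap"])
    (use H_integrable G_sq_le_H H_nonneg kap_pos in \<open>auto simp: abs_of_nonneg\<close>)

lemma Q_integrable: "integrable M (\<lambda>\<omega>. Q (z k \<omega>))"
proof -
  have "integrable M (\<lambda>\<omega>. H (z k \<omega>) + qbar - kap * norm (G (z k \<omega>))^2)"
    using H_integrable G_sq_integrable by simp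
  thus ?thesis by (simp add: H_def)
qed

section \<open>Second moments of the noise\<close>

definition v where "v k = (\<integral>\<omega>. norm (e k \<omega>)^2 \<partial>M)"
definition h where "h k = (\<integral>\<omega>. H (z k \<omega>) \<partial>M)"
definition gq where "gq k = (\<integral>\<omega>. norm (G (z k \<omega>))^2 \<partial>M)"
definition V where "V n i = (\<Sum>j=n..<i. (\<alpha> j)^2 * v j)"
definition a where "a k = (\<alpha> k)^2 * max A ((\<sigma> k)^2)"

lemma e_sq_integrable: "integrable M (\<lambda>\<omega>. norm (e k \<omega>)^2)"
  and v_le: "v k \<le> (\<sigma> k)^2 + A * h k"
  unfolding v_def h_def using e_square_integrable_step[OF H_integrable] by auto

lemma v_nonneg: "0 \<le> v k" unfolding v_def by (intro integral_nonneg_AE) auto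
lemma h_nonneg: "0 \<le> h k" unfolding h_def by (intro integral_nonneg_AE) (auto simp: H_nonneg)
lemma gq_nonneg: "0 \<le> gq k" unfolding gq_def by (intro integral_nonneg_AE) auto
lemma a_nonneg: "0 \<le> a k" unfolding a_def using A_nonneg by auto
lemma V_nonneg: "0 \<le> V n i" unfolding V_def by (intro sum_nonneg) (auto simp: v_nonneg)

lemma V_mono: "i \<le> i' \<Longrightarrow> V n i \<le> V n i'"
  unfolding V_def by (intro sum_mono2) (auto simp: v_nonneg)

text \<open>The maximum in \<open>a\<close> serves both parts of the variance bound, giving the
  relative form 1 + h required by the scalar recursion.\<close>

lemma step_variance_le: "(\<alpha> k)^2 * v k \<le> a k * (1 + h k)"
proof -
  have "v k \<le> max A ((\<sigma> k)^2) + max A ((\<sigma> k)^2) * h k"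
    using v_le[of k] mult_right_mono[of A "max A ((\<sigma> k)^2)" "h k"] h_nonneg[of k] by linarith
  hence "(\<alpha> k)^2 * v k \<le> (\<alpha> k)^2 * (max A ((\<sigma> k)^2) + max A ((\<sigma> k)^2) * h k)"
    by (intro mult_left_mono) auto
  thus ?thesis by (simp add: a_def algebra_simps)
qed

text \<open>Done coordinatewise, since the conditional expectation used here is real-valued; square
  integrability of both factors makes each product integrable.\<close>

lemma e_orthogonal:
  assumes w: "w \<in> borel_measurable (F k)" and wi: "integrable M (\<lambda>\<omega>. norm (w \<omega>)^2)"
  shows "(\<integral>\<omega>. w \<omega> \<bullet> e k \<omega> \<partial>M) = 0"
proof -
  interpret sigma_finite_subalgebra M "F k" by (rule sfs)
  have wM [measurable]: "w \<in> borel_measurable M" by (rule meas_F_M[OF w])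
  have ei: "integrable M (e k)" by (rule integrable_of_square_integrable[OF _ e_sq_integrable]) simp
  have comp: "integrable M (\<lambda>\<omega>. (w \<omega> \<bullet> b) * (e k \<omega> \<bullet> b)) \<and> (\<integral>\<omega>. (w \<omega> \<bullet> b) * (e k \<omega> \<bullet> b) \<partial>M) = 0"
    if b: "b \<in> Basis" for b
  proof
    have sq: "(x \<bullet> b)^2 \<le> norm x^2" for x :: 'a
      using Basis_le_norm[OF b, of x] power_mono[of "\<bar>x \<bullet> b\<bar>" "norm x" 2] by simp
    have c: "integrable M (\<lambda>\<omega>. norm (X \<omega> \<bullet> b)^2)"
      if "integrable M (\<lambda>\<omega>. norm (X \<omega>)^2)" "X \<in> borel_measurable M" for X :: "'w \<Rightarrow> 'a"
      by (rule Bochner_Integration.integrable_bound[OF that(1)]) (use that sq in auto)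
    show i: "integrable M (\<lambda>\<omega>. (w \<omega> \<bullet> b) * (e k \<omega> \<bullet> b))"
      using integrable_inner_square_integrable[of "\<lambda>\<omega>. w \<omega> \<bullet> b" M "\<lambda>\<omega>. e k \<omega> \<bullet> b"]
        c[OF wi] c[OF e_sq_integrable] by simp
    have "(\<integral>\<omega>. (w \<omega> \<bullet> b) * (e k \<omega> \<bullet> b) \<partial>M)
        = (\<integral>\<omega>. (w \<omega> \<bullet> b) * real_cond_exp M (F k) (\<lambda>\<omega>. e k \<omega> \<bullet> b) \<omega> \<partial>M)"
      by (rule real_cond_exp_intg(2)[symmetric, OF i]) (use w in auto)
    also have "\<dots> = (\<integral>\<omega>. 0 \<partial>M)"
      by (intro integral_cong_AE) (use e_unbiased[OF b ei] in auto)
    finally show "(\<integral>\<omega>. (w \<omega> \<bullet> b) * (e k \<omega> \<bullet> b) \<partial>M) = 0" by simp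
  qed
  have "(\<integral>\<omega>. w \<omega> \<bullet> e k \<omega> \<partial>M) = (\<integral>\<omega>. (\<Sum>b\<in>Basis. (w \<omega> \<bullet> b) * (e k \<omega> \<bullet> b)) \<partial>M)"
    by (subst euclidean_inner) simp
  also have "\<dots> = (\<Sum>b\<in>Basis. \<integral>\<omega>. (w \<omega> \<bullet> b) * (e k \<omega> \<bullet> b) \<partial>M)"
    by (intro Bochner_Integration.integral_sum) (use comp in auto)
  finally show ?thesis using comp by simp
qed

text \<open>A martingale transform with predictable weights bounded by 1 does not increase the
  variance bound. Weight 1 gives the plain noise; a no-exit indicator gives the stopped
  noise.\<close>

lemma weighted_noise:
  assumes q: "\<And>j. q j \<in> borel_measurable (F j)" and q1: "\<And>j \<omega>. \<bar>q j \<omega>\<bar> \<le> (1::real)" and ni: "n \<le> i"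
  shows "(\<lambda>\<omega>. \<Sum>j=n..<i. \<alpha> j *\<^sub>R (q j \<omega> *\<^sub>R e j \<omega>)) \<in> borel_measurable (F i) \<and>
    integrable M (\<lambda>\<omega>. norm (\<Sum>j=n..<i. \<alpha> j *\<^sub>R (q j \<omega> *\<^sub>R e j \<omega>))^2) \<and>
    (\<integral>\<omega>. norm (\<Sum>j=n..<i. \<alpha> j *\<^sub>R (q j \<omega> *\<^sub>R e j \<omega>))^2 \<partial>M) \<le> V n i"
  using ni
proof (induction i rule: dec_induct)
  case base show ?case by (simp add: V_def)
next
  case (step i)
  define X where "X \<omega> = (\<Sum>j=n..<i. \<alpha> j *\<^sub>R (q j \<omega> *\<^sub>R e j \<omega>))" for \<omega>
  have Xm: "X \<in> borel_measurable (F i)" and Xi: "integrable M (\<lambda>\<omega>. norm (X \<omega>)^2)"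
    and Xv: "(\<integral>\<omega>. norm (X \<omega>)^2 \<partial>M) \<le> V n i"
    using step.IH by (simp_all add: X_def[abs_def])
  have [measurable]: "X \<in> borel_measurable M" "q i \<in> borel_measurable M"
    using Xm q by (auto intro: meas_F_M)
  have S: "(\<Sum>j=n..<Suc i. \<alpha> j *\<^sub>R (q j \<omega> *\<^sub>R e j \<omega>)) = X \<omega> + \<alpha> i *\<^sub>R (q i \<omega> *\<^sub>R e i \<omega>)" for \<omega>
    using step.hyps by (simp add: X_def)
  have qm: "q i \<in> borel_measurable (F i)" by (rule q)
  have m: "(\<lambda>\<omega>. X \<omega> + \<alpha> i *\<^sub>R (q i \<omega> *\<^sub>R e i \<omega>)) \<in> borel_measurable (F (Suc i))"
    using meas_mono[OF _ Xm, of "Suc i"] meas_mono[OF _ qm, of "Suc i"] e_meas[of i] by simp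
  have q2: "(q i \<omega>)^2 * norm x^2 \<le> norm x^2" for \<omega> and x :: 'a
    using q1[of i \<omega>] by (intro mult_left_le_one_le) (auto simp: abs_square_le_1)
  have ie: "integrable M (\<lambda>\<omega>. norm (q i \<omega> *\<^sub>R e i \<omega>)^2)"
    by (rule Bochner_Integration.integrable_bound[OF e_sq_integrable[of i]])
      (use q2 in \<open>auto simp: power_mult_distrib\<close>)
  have iX: "integrable M (\<lambda>\<omega>. norm (q i \<omega> *\<^sub>R X \<omega>)^2)"
    by (rule Bochner_Integration.integrable_bound[OF Xi])
      (use q2 in \<open>auto simp: power_mult_distrib\<close>)
  \<comment> \<open>The weight is moved onto \<open>X\<close>, so that the factor paired with
    \<open>e i\<close> is measurable for \<open>F i\<close>.\<close>
  have orth: "(\<integral>\<omega>. (q i \<omega> *\<^sub>R X \<omega>) \<bullet> e i \<omega> \<partial>M) = 0"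
    using Xm qm iX by (intro e_orthogonal) simp_all
  have iXe: "integrable M (\<lambda>\<omega>. (q i \<omega> *\<^sub>R X \<omega>) \<bullet> e i \<omega>)"
    by (rule integrable_inner_square_integrable[OF _ _ iX e_sq_integrable]) auto
  have ex: "norm (X \<omega> + \<alpha> i *\<^sub>R (q i \<omega> *\<^sub>R e i \<omega>))^2
      = norm (X \<omega>)^2 + 2 * \<alpha> i * ((q i \<omega> *\<^sub>R X \<omega>) \<bullet> e i \<omega>) + (\<alpha> i)^2 * norm (q i \<omega> *\<^sub>R e i \<omega>)^2" for \<omega>
    by (simp add: norm_sq_add power_mult_distrib)
  have int: "integrable M (\<lambda>\<omega>. norm (X \<omega> + \<alpha> i *\<^sub>R (q i \<omega> *\<^sub>R e i \<omega>))^2)"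
    unfolding ex using Xi ie iXe by (intro Bochner_Integration.integrable_add integrable_mult_right)
  have "(\<integral>\<omega>. norm (X \<omega> + \<alpha> i *\<^sub>R (q i \<omega> *\<^sub>R e i \<omega>))^2 \<partial>M)
      = (\<integral>\<omega>. norm (X \<omega>)^2 \<partial>M) + 2 * \<alpha> i * (\<integral>\<omega>. (q i \<omega> *\<^sub>R X \<omega>) \<bullet> e i \<omega> \<partial>M)
        + (\<alpha> i)^2 * (\<integral>\<omega>. norm (q i \<omega> *\<^sub>R e i \<omega>)^2 \<partial>M)"
    unfolding ex using Xi ie iXe
    by (simp only: Bochner_Integration.integral_add Bochner_Integration.integrable_add
        integrable_mult_right integral_mult_right_zero)
  also have "\<dots> \<le> V n i + 2 * \<alpha> i * 0 + (\<alpha> i)^2 * v i"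
  proof (intro add_mono mult_left_mono)
    show "(\<integral>\<omega>. norm (q i \<omega> *\<^sub>R e i \<omega>)^2 \<partial>M) \<le> v i" unfolding v_def
      by (intro integral_mono ie e_sq_integrable) (use q2 in \<open>auto simp: power_mult_distrib\<close>)
  qed (use Xv orth alpha_pos[of i] in auto)
  also have "\<dots> = V n (Suc i)" using step.hyps by (simp add: V_def)
  finally show ?case unfolding S using m int by blast
qed

lemma noise_eq: "path.noise \<omega> n i = (\<Sum>j=n..<i. \<alpha> j *\<^sub>R e j \<omega>)"
  by (rule path.noise_def)

lemma
  assumes "n \<le> i"
  shows noise_measurable_F: "(\<lambda>\<omega>. path.noise \<omega> n i) \<in> borel_measurable (F i)"
    and noise_sq_integrable: "integrable M (\<lambda>\<omega>. norm (path.noise \<omega> n i)^2)"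
    and noise_variance: "(\<integral>\<omega>. norm (path.noise \<omega> n i)^2 \<partial>M) \<le> V n i"
  using weighted_noise[of "\<lambda>_ _. 1", OF _ _ assms] unfolding noise_eq by simp_all

text \<open>The sum stopped at its first exit from the ball of radius \<open>\<epsilon>\<close> is again a weighted noise sum,
  so the bound is Markov's inequality for the stopped sum.\<close>

lemma noise_maximal_inequality:
  assumes nm: "n \<le> m" and eps: "0 < \<epsilon>"
  shows "{\<omega>\<in>space M. \<exists>i\<in>{n..m}. \<epsilon> \<le> norm (path.noise \<omega> n i)} \<in> sets M"
    "measure M {\<omega>\<in>space M. \<exists>i\<in>{n..m}. \<epsilon> \<le> norm (path.noise \<omega> n i)} \<le> V n m / \<epsilon>^2"
proof -
  have [measurable]: "(\<lambda>\<omega>. path.noise \<omega> n i) \<in> borel_measurable M" for i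
    unfolding noise_eq by simp
  show s: "{\<omega>\<in>space M. \<exists>i\<in>{n..m}. \<epsilon> \<le> norm (path.noise \<omega> n i)} \<in> sets M" by measurable
  \<comment> \<open>The noise up to index j involves only errors before j, so this indicator is
    known in \<open>F j\<close> and may multiply \<open>e j\<close>.\<close>
  define q where "q j \<omega> = (if \<forall>i\<in>{n..j}. norm (path.noise \<omega> n i) < \<epsilon> then 1 else 0 :: real)" for j \<omega>
  have qm: "q j \<in> borel_measurable (F j)" for j
  proof -
    have [measurable]: "(\<lambda>\<omega>. path.noise \<omega> n i) \<in> borel_measurable (F j)" if "i \<in> {n..j}" for i
      using that noise_measurable_F[of n i] by (intro meas_mono[of i j]) auto
    have "Measurable.pred (F j) (\<lambda>\<omega>. \<forall>i\<in>{n..j}. norm (path.noise \<omega> n i) < \<epsilon>)"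
      by (intro pred_intros_finite) (auto intro!: borel_measurable_pred_less)
    thus ?thesis unfolding q_def by simp
  qed
  define Y where "Y \<omega> = (\<Sum>j=n..<m. \<alpha> j *\<^sub>R (q j \<omega> *\<^sub>R e j \<omega>))" for \<omega>
  have Y: "Y \<in> borel_measurable (F m)" "integrable M (\<lambda>\<omega>. norm (Y \<omega>)^2)" "(\<integral>\<omega>. norm (Y \<omega>)^2 \<partial>M) \<le> V n m"
    using weighted_noise[of q, OF qm _ nm] by (auto simp: Y_def[abs_def] q_def)
  have sub: "{\<omega>\<in>space M. \<exists>i\<in>{n..m}. \<epsilon> \<le> norm (path.noise \<omega> n i)} \<subseteq> {\<omega>\<in>space M. \<epsilon>^2 \<le> norm (Y \<omega>)^2}"
  proof safe
    fix \<omega> i assume "\<omega> \<in> space M" "i \<in> {n..m}" "\<epsilon> \<le> norm (path.noise \<omega> n i)"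
    define l where "l = (LEAST i. i \<in> {n..m} \<and> \<epsilon> \<le> norm (path.noise \<omega> n i))"
    have l: "l \<in> {n..m}" "\<epsilon> \<le> norm (path.noise \<omega> n l)"
      using LeastI[of "\<lambda>i. i \<in> {n..m} \<and> \<epsilon> \<le> norm (path.noise \<omega> n i)" i]
        \<open>i \<in> {n..m}\<close> \<open>\<epsilon> \<le> norm (path.noise \<omega> n i)\<close> unfolding l_def by auto
    have before: "norm (path.noise \<omega> n i) < \<epsilon>" if "n \<le> i" "i < l" for i
      using not_less_Least[of i "\<lambda>i. i \<in> {n..m} \<and> \<epsilon> \<le> norm (path.noise \<omega> n i)"] that l(1)
      unfolding l_def by auto
    \<comment> \<open>Weights are 1 before the first exit \<open>l\<close> and 0 from
      \<open>l\<close> on, so the stopped sum equals the noise at \<open>l\<close>.\<close>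
    have "Y \<omega> = (\<Sum>j=n..<l. \<alpha> j *\<^sub>R (q j \<omega> *\<^sub>R e j \<omega>)) + (\<Sum>j=l..<m. \<alpha> j *\<^sub>R (q j \<omega> *\<^sub>R e j \<omega>))"
      unfolding Y_def using l(1) by (simp add: sum.atLeastLessThan_concat)
    also have "(\<Sum>j=l..<m. \<alpha> j *\<^sub>R (q j \<omega> *\<^sub>R e j \<omega>)) = 0"
      using l by (intro sum.neutral) (force simp: q_def)
    also have "(\<Sum>j=n..<l. \<alpha> j *\<^sub>R (q j \<omega> *\<^sub>R e j \<omega>)) = (\<Sum>j=n..<l. \<alpha> j *\<^sub>R e j \<omega>)"
      using before by (intro sum.cong) (auto simp: q_def)
    finally have "Y \<omega> = path.noise \<omega> n l" by (simp add: noise_eq)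
    thus "\<epsilon>^2 \<le> norm (Y \<omega>)^2" using l(2) eps by (intro power_mono) auto
  qed
  have [measurable]: "Y \<in> borel_measurable M" by (rule meas_F_M[OF Y(1)])
  have "measure M {\<omega>\<in>space M. \<exists>i\<in>{n..m}. \<epsilon> \<le> norm (path.noise \<omega> n i)}
      \<le> measure M {\<omega>\<in>space M. \<epsilon>^2 \<le> norm (Y \<omega>)^2}"
    by (intro finite_measure_mono sub) measurable
  also have "\<dots> \<le> (\<integral>\<omega>. norm (Y \<omega>)^2 \<partial>M) / \<epsilon>^2"
    using Y(2) eps by (intro integral_Markov_inequality_measure[where A = "space M"]) auto
  also have "\<dots> \<le> V n m / \<epsilon>^2" using Y(3) by (intro divide_right_mono) auto
  finally show "measure M {\<omega>\<in>space M. \<exists>i\<in>{n..m}. \<epsilon> \<le> norm (path.noise \<omega> n i)} \<le> V n m / \<epsilon>^2" .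
qed

section \<open>Expectations over one window\<close>

lemma
  assumes ni: "n \<le> i" and t: "(\<Sum>j=n..<i. \<alpha> j) \<le> T"
  shows R_integrable: "integrable M (\<lambda>\<omega>. path.R \<omega> n i)"
    and R_expectation: "(\<integral>\<omega>. path.R \<omega> n i \<partial>M) \<le> 2 * V n i"
proof -
  have int: "integrable M (\<lambda>\<omega>. \<alpha> j * norm (path.noise \<omega> n j)^2)" if "j \<in> {n..<i}" for j
    using that by (intro integrable_mult_right noise_sq_integrable) auto
  show "integrable M (\<lambda>\<omega>. path.R \<omega> n i)"
    unfolding path.R_def
    by (intro Bochner_Integration.integrable_add Bochner_Integration.integrable_sum noise_sq_integrable ni int)
  have "(\<integral>\<omega>. path.R \<omega> n i \<partial>M)
      = (\<Sum>j=n..<i. \<alpha> j * (\<integral>\<omega>. norm (path.noise \<omega> n j)^2 \<partial>M)) + (\<integral>\<omega>. norm (path.noise \<omega> n i)^2 \<partial>M)"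
    unfolding path.R_def
    by (subst Bochner_Integration.integral_add)
      (use int in \<open>auto intro!: Bochner_Integration.integrable_sum noise_sq_integrable ni
          simp: Bochner_Integration.integral_sum\<close>)
  also have "\<dots> \<le> (\<Sum>j=n..<i. \<alpha> j * V n i) + V n i"
  proof (intro add_mono sum_mono mult_left_mono)
    fix j assume "j \<in> {n..<i}"
    thus "(\<integral>\<omega>. norm (path.noise \<omega> n j)^2 \<partial>M) \<le> V n i"
      using noise_variance[of n j] V_mono[of j i n] by simp
  qed (use noise_variance[OF ni] alpha_pos in \<open>auto intro: less_imp_le\<close>)
  also have "(\<Sum>j=n..<i. \<alpha> j * V n i) = (\<Sum>j=n..<i. \<alpha> j) * V n i" by (simp add: sum_distrib_right)
  also have "\<dots> \<le> 1 * V n i" using t T_bounds(1) V_nonneg by (intro mult_right_mono) auto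
  finally show "(\<integral>\<omega>. path.R \<omega> n i \<partial>M) \<le> 2 * V n i" by simp
qed

lemma
  assumes ni: "n \<le> i" and t: "(\<Sum>j=n..<i. \<alpha> j) \<le> T"
  shows displacement_integrable: "integrable M (\<lambda>\<omega>. norm (z i \<omega> - z n \<omega>)^2)"
    and displacement_expectation: "(\<integral>\<omega>. norm (z i \<omega> - z n \<omega>)^2 \<partial>M) \<le> B * (gq n + 2 * V n i)"
proof -
  have iB: "integrable M (\<lambda>\<omega>. B * (norm (G (z n \<omega>))^2 + path.R \<omega> n i))"
    using G_sq_integrable R_integrable[OF assms] by simp
  show int: "integrable M (\<lambda>\<omega>. norm (z i \<omega> - z n \<omega>)^2)"
  proof (rule Bochner_Integration.integrable_bound[OF iB])
    show "AE \<omega> in M. norm (norm (z i \<omega> - z n \<omega>)^2) \<le> norm (B * (norm (G (z n \<omega>))^2 + path.R \<omega> n i))"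
    proof (rule AE_I2)
      fix \<omega>
      show "norm (norm (z i \<omega> - z n \<omega>)^2) \<le> norm (B * (norm (G (z n \<omega>))^2 + path.R \<omega> n i))"
        using path.window_displacement_sq[OF assms, of \<omega>] by simp
    qed
  qed simp
  have "(\<integral>\<omega>. norm (z i \<omega> - z n \<omega>)^2 \<partial>M) \<le> (\<integral>\<omega>. B * (norm (G (z n \<omega>))^2 + path.R \<omega> n i) \<partial>M)"
    by (intro integral_mono int iB path.window_displacement_sq assms)
  also have "\<dots> = B * (gq n + (\<integral>\<omega>. path.R \<omega> n i \<partial>M))"
    using G_sq_integrable R_integrable[OF assms] by (simp add: gq_def)
  also have "\<dots> \<le> B * (gq n + 2 * V n i)"
    using R_expectation[OF assms] B_pos by (intro mult_left_mono) auto
  finally show "(\<integral>\<omega>. norm (z i \<omega> - z n \<omega>)^2 \<partial>M) \<le> B * (gq n + 2 * V n i)" .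
qed

lemma gq_le_h: "gq k \<le> h k / kap"
proof -
  have "gq k \<le> (\<integral>\<omega>. H (z k \<omega>) / kap \<partial>M)" unfolding gq_def
    using H_integrable by (intro integral_mono G_sq_integrable G_sq_le_H) auto
  thus ?thesis by (simp add: h_def)
qed

definition C3 where "C3 = C1 * (1 + B / kap + 2 * B)"

lemma C3_ge_1: "C3 \<ge> 1"
proof -
  have "1 * 1 \<le> C1 * (1 + B / kap + 2 * B)"
    using C1_ge_1 B_pos kap_pos by (intro mult_mono) auto
  thus ?thesis by (simp add: C3_def)
qed

lemma h_window_growth:
  assumes ni: "n \<le> i" and t: "(\<Sum>j=n..<i. \<alpha> j) \<le> T"
  shows "h i \<le> C3 * (h n + V n i)"
proof -
  have "h i \<le> (\<integral>\<omega>. C1 * (H (z n \<omega>) + norm (z i \<omega> - z n \<omega>)^2) \<partial>M)"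
    unfolding h_def using displacement_integrable[OF assms] H_integrable
    by (intro integral_mono H_growth) auto
  also have "\<dots> = C1 * (h n + (\<integral>\<omega>. norm (z i \<omega> - z n \<omega>)^2 \<partial>M))"
    using displacement_integrable[OF assms] H_integrable by (simp add: h_def)
  also have "\<dots> \<le> C1 * ((1 + B / kap + 2 * B) * (h n + V n i))"
  proof (rule mult_left_mono)
    have "(\<integral>\<omega>. norm (z i \<omega> - z n \<omega>)^2 \<partial>M) \<le> B * (h n / kap + 2 * V n i)"
      using gq_le_h[of n] B_pos
      by (intro order_trans[OF displacement_expectation[OF assms]] mult_left_mono) auto
    also have "\<dots> = (B / kap) * h n + (2 * B) * V n i" by (simp add: algebra_simps)
    finally have "h n + (\<integral>\<omega>. norm (z i \<omega> - z n \<omega>)^2 \<partial>M) \<le> (1 + B / kap) * h n + (2 * B) * V n i"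
      by (simp add: algebra_simps)
    also have "\<dots> \<le> (1 + B / kap + 2 * B) * h n + (1 + B / kap + 2 * B) * V n i"
      using B_pos kap_pos h_nonneg V_nonneg
      by (intro add_mono[OF mult_right_mono mult_right_mono]) auto
    finally show "h n + (\<integral>\<omega>. norm (z i \<omega> - z n \<omega>)^2 \<partial>M) \<le> (1 + B / kap + 2 * B) * (h n + V n i)"
      by (simp add: distrib_left)
  qed (use C1_ge_1 in auto)
  finally show ?thesis by (simp add: C3_def mult.assoc)
qed

text \<open>A bootstrap: the variance up to i depends on the expected merit strictly before i, which
  in turn is bounded by the earlier variance. Smallness of the weights keeps the bound 2 C3 (1 + h
  n) from deteriorating.\<close>

lemma V_window_bound:
  assumes nm: "n \<le> m" and t: "(\<Sum>j=n..<m. \<alpha> j) \<le> T"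
    and small: "(1 + 2 * C3) * (\<Sum>j=n..<m. a j) \<le> 1"
  shows "V n m \<le> (1 + 2 * C3) * (\<Sum>j=n..<m. a j) * (1 + h n)"
proof -
  have Vle: "V n i \<le> (1 + 2 * C3) * (\<Sum>j=n..<m. a j) * (1 + h n)"
    if i: "n \<le> i" "i \<le> m" and hj: "\<And>j. n \<le> j \<Longrightarrow> j < i \<Longrightarrow> h j \<le> 2 * C3 * (1 + h n)" for i
  proof -
    have "V n i \<le> (\<Sum>j=n..<i. a j * ((1 + 2 * C3) * (1 + h n)))"
      unfolding V_def
    proof (rule sum_mono)
      fix j assume j: "j \<in> {n..<i}"
      have "1 + h j \<le> (1 + 2 * C3) * (1 + h n)"
        using hj[of j] j h_nonneg[of n] by (simp add: algebra_simps)
      thus "(\<alpha> j)^2 * v j \<le> a j * ((1 + 2 * C3) * (1 + h n))"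
        using step_variance_le[of j] a_nonneg[of j] by (meson mult_left_mono order_trans)
    qed
    also have "\<dots> \<le> (\<Sum>j=n..<m. a j * ((1 + 2 * C3) * (1 + h n)))"
      using i C3_ge_1 h_nonneg a_nonneg by (intro sum_mono2) auto
    also have "\<dots> = (1 + 2 * C3) * (\<Sum>j=n..<m. a j) * (1 + h n)"
      by (simp add: sum_distrib_right[symmetric] mult_ac)
    finally show ?thesis .
  qed
  \<comment> \<open>Strong induction suits the half-open sums: \<open>V n i\<close> involves only
    indices below i.\<close>
  have hle: "h i \<le> 2 * C3 * (1 + h n)" if "n \<le> i" "i \<le> m" for i
    using that
  proof (induction i rule: less_induct)
    case (less i)
    have "V n i \<le> (1 + 2 * C3) * (\<Sum>j=n..<m. a j) * (1 + h n)"
      using less by (intro Vle) auto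
    also have "\<dots> \<le> 1 * (1 + h n)" using small h_nonneg by (intro mult_right_mono) auto
    finally have V1: "V n i \<le> 1 + h n" by simp
    have "(\<Sum>j=n..<i. \<alpha> j) \<le> (\<Sum>j=n..<m. \<alpha> j)"
      using less.prems alpha_pos by (intro sum_mono2) (auto intro: less_imp_le)
    hence "h i \<le> C3 * (h n + V n i)" using less.prems t by (intro h_window_growth) auto
    also have "\<dots> \<le> C3 * (2 * (1 + h n))" using V1 C3_ge_1 by (intro mult_left_mono) auto
    finally show ?case by (simp only: mult_ac)
  qed
  show ?thesis using nm hle by (intro Vle) auto
qed

text \<open>Integrating the pathwise descent and inserting the variance bound gives a recursion for
  \<open>h\<close> at the endpoints with summable relative errors.\<close>

lemma good_windows:
  obtains nn where "strict_mono nn"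
    "\<And>k. T / 2 \<le> (\<Sum>j=nn k..<nn (Suc k). \<alpha> j)" "\<And>k. (\<Sum>j=nn k..<nn (Suc k). \<alpha> j) \<le> T"
    "summable (\<lambda>k. V (nn k) (nn (Suc k)))" "convergent (\<lambda>k. h (nn k))" "(\<lambda>k. gq (nn k)) \<longlonglongrightarrow> 0"
proof -
  have sa: "summable a" using step_sum by (simp add: a_def[abs_def])
  have "1 / (1 + 2 * C3) > 0" using C3_ge_1 by simp
  \<comment> \<open>The Cauchy criterion makes every block of weights after \<open>n0\<close> small
    enough for \<open>V_window_bound\<close>, whatever the window.\<close>
  then obtain n0 where n0: "\<And>m n. m \<ge> n0 \<Longrightarrow> norm (sum a {m..<n}) < 1 / (1 + 2 * C3)"
    using sa unfolding summable_Cauchy by blast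
  obtain nn where nn: "strict_mono nn" "nn 0 \<ge> n0"
    "\<And>k. T / 2 \<le> (\<Sum>j=nn k..<nn (Suc k). \<alpha> j)" "\<And>k. (\<Sum>j=nn k..<nn (Suc k). \<alpha> j) \<le> T"
    using divergent_sum_windows[OF alpha_pos alpha_div alpha_lim T_pos] by metis
  have mono: "nn k \<le> nn (Suc k)" for k using nn(1) by (simp add: strict_mono_less_eq)
  have ge: "nn k \<ge> n0" for k using nn(1,2) by (meson le0 order_trans strict_mono_less_eq)
  define s where "s k = (\<Sum>j=nn k..<nn (Suc k). a j)" for k
  have s0: "0 \<le> s k" for k unfolding s_def by (intro sum_nonneg a_nonneg)
  have ss: "summable s" unfolding s_def
    by (intro summable_window_sums sa a_nonneg strict_mono_mono nn)
  have small: "(1 + 2 * C3) * s k \<le> 1" for k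
  proof -
    have "s k < 1 / (1 + 2 * C3)" using n0[OF ge, of k "nn (Suc k)"] s0[of k] by (simp add: s_def)
    thus ?thesis using C3_ge_1 by (simp add: field_simps)
  qed
  have Vk: "V (nn k) (nn (Suc k)) \<le> (1 + 2 * C3) * s k * (1 + h (nn k))" for k
    using V_window_bound[OF mono nn(4)] small[of k] by (simp add: s_def)
  define E where "E = 4 * D * (2 * C + 1)^2 / T"
  have E: "E \<ge> 0" using D_pos T_pos by (simp add: E_def)
  have desc: "h (nn (Suc k)) \<le> h (nn k) - (c * T / 4) * gq (nn k) + (2 * E * (1 + 2 * C3) * s k) * (1 + h (nn k))" for k
  proof -
    note iR = R_integrable[OF mono nn(4), of k]
    have "h (nn (Suc k)) \<le> (\<integral>\<omega>. H (z (nn k) \<omega>) - (c * T / 4) * norm (G (z (nn k) \<omega>))^2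
        + E * path.R \<omega> (nn k) (nn (Suc k)) \<partial>M)"
      unfolding h_def
    proof (rule integral_mono[OF H_integrable])
      show "integrable M (\<lambda>\<omega>. H (z (nn k) \<omega>) - (c * T / 4) * norm (G (z (nn k) \<omega>))^2
        + E * path.R \<omega> (nn k) (nn (Suc k)))"
        using H_integrable G_sq_integrable iR by simp
      show "H (z (nn (Suc k)) \<omega>) \<le> H (z (nn k) \<omega>) - (c * T / 4) * norm (G (z (nn k) \<omega>))^2
        + E * path.R \<omega> (nn k) (nn (Suc k))" for \<omega>
        unfolding E_def by (rule path.window_descent[OF mono nn(3,4)])
    qed
    also have "\<dots> = h (nn k) - (c * T / 4) * gq (nn k) + E * (\<integral>\<omega>. path.R \<omega> (nn k) (nn (Suc k)) \<partial>M)"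
      using H_integrable G_sq_integrable iR by (simp add: h_def gq_def)
    also have "E * (\<integral>\<omega>. path.R \<omega> (nn k) (nn (Suc k)) \<partial>M) \<le> E * (2 * ((1 + 2 * C3) * s k * (1 + h (nn k))))"
      using R_expectation[OF mono nn(4), of k] Vk[of k] E by (intro mult_left_mono) auto
    finally show ?thesis by (simp only: mult_ac)
  qed
  have b0: "0 \<le> 2 * E * (1 + 2 * C3) * s k" for k using E C3_ge_1 s0 by auto
  have sb: "summable (\<lambda>k. 2 * E * (1 + 2 * C3) * s k)" using ss by (rule summable_mult)
  have g0: "0 \<le> (c * T / 4) * gq (nn k)" for k using c_pos T_pos gq_nonneg by auto
  note rs = robbins_siegmund_deterministic[where h = "\<lambda>k. h (nn k)", OF desc h_nonneg g0 b0 sb]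
  obtain b where b: "\<And>k. h (nn k) \<le> b" using rs(3) by blast
  \<comment> \<open>Boundedness of \<open>h\<close> at the endpoints turns the relative variance
    bound into an absolute, summable one.\<close>
  have "summable (\<lambda>k. V (nn k) (nn (Suc k)))"
  proof (rule summable_comparison_test)
    show "summable (\<lambda>k. (1 + 2 * C3) * s k * (1 + b))"
      by (intro summable_mult summable_mult2 ss)
    have "V (nn k) (nn (Suc k)) \<le> (1 + 2 * C3) * s k * (1 + b)" for k
      using b[of k] C3_ge_1 s0[of k] by (intro order_trans[OF Vk mult_left_mono]) auto
    thus "\<exists>N. \<forall>k\<ge>N. norm (V (nn k) (nn (Suc k))) \<le> (1 + 2 * C3) * s k * (1 + b)"
      using V_nonneg by simp
  qed
  moreover have "(\<lambda>k. (4 / (c * T)) * ((c * T / 4) * gq (nn k))) \<longlonglongrightarrow> (4 / (c * T)) * 0"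
    by (intro tendsto_intros summable_LIMSEQ_zero rs(2))
  hence "(\<lambda>k. gq (nn k)) \<longlonglongrightarrow> 0" using c_pos T_pos by simp
  ultimately show ?thesis using that nn rs(1) by blast
qed

text \<open>For means, the maximum over a window stands outside the expectation, so the
  second-moment displacement bound at each index suffices.\<close>

theorem expectation_limits:
  "gq \<longlonglongrightarrow> 0" "convergent (\<lambda>k. \<integral>\<omega>. Q (z k \<omega>) \<partial>M)"
proof -
  obtain nn where nn: "strict_mono nn"
    "\<And>k. T / 2 \<le> (\<Sum>j=nn k..<nn (Suc k). \<alpha> j)" "\<And>k. (\<Sum>j=nn k..<nn (Suc k). \<alpha> j) \<le> T"
    "summable (\<lambda>k. V (nn k) (nn (Suc k)))" "convergent (\<lambda>k. h (nn k))" "(\<lambda>k. gq (nn k)) \<longlonglongrightarrow> 0"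
    using good_windows by blast
  define q where "q k = (\<integral>\<omega>. Q (z k \<omega>) \<partial>M)" for k
  define d where "d k = B * (gq (nn k) + 2 * V (nn k) (nn (Suc k)))" for k
  have "d \<longlonglongrightarrow> B * (0 + 2 * 0)"
    unfolding d_def by (intro tendsto_intros nn(6) summable_LIMSEQ_zero nn(4))
  hence d0: "d \<longlonglongrightarrow> 0" by simp
  have short: "(\<Sum>j=nn k..<i. \<alpha> j) \<le> T" if "nn k \<le> i" "i \<le> nn (Suc k)" for k i
  proof -
    have "(\<Sum>j=nn k..<i. \<alpha> j) \<le> (\<Sum>j=nn k..<nn (Suc k). \<alpha> j)"
      using that alpha_pos by (intro sum_mono2) (auto intro: less_imp_le)
    thus ?thesis using nn(3)[of k] by linarith
  qed
  have disp: "(\<integral>\<omega>. norm (z i \<omega> - z (nn k) \<omega>)^2 \<partial>M) \<le> d k" if ki: "nn k \<le> i" "i \<le> nn (Suc k)" for k i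
  proof -
    have "(\<integral>\<omega>. norm (z i \<omega> - z (nn k) \<omega>)^2 \<partial>M) \<le> B * (gq (nn k) + 2 * V (nn k) i)"
      by (rule displacement_expectation[OF ki(1) short[OF ki]])
    also have "\<dots> \<le> d k" unfolding d_def
      using B_pos V_mono[OF ki(2)] by (intro mult_left_mono) auto
    finally show ?thesis .
  qed
  show "gq \<longlonglongrightarrow> 0"
  proof (rule tendsto_from_windows[OF nn(1)])
    fix k i assume ki: "nn k \<le> i" "i \<le> nn (Suc k)"
    note di = displacement_integrable[OF ki(1) short[OF ki]]
    have "gq i \<le> (\<integral>\<omega>. 2 * norm (G (z (nn k) \<omega>))^2 + 2 * C^2 * norm (z i \<omega> - z (nn k) \<omega>)^2 \<partial>M)"
      unfolding gq_def using G_sq_integrable di by (intro integral_mono G_sq_growth) auto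
    also have "\<dots> = 2 * gq (nn k) + 2 * C^2 * (\<integral>\<omega>. norm (z i \<omega> - z (nn k) \<omega>)^2 \<partial>M)"
      using G_sq_integrable di by (simp add: gq_def)
    also have "\<dots> \<le> 2 * gq (nn k) + 2 * C^2 * d k"
      using disp[OF ki] by (intro add_mono mult_left_mono) auto
    finally show "\<bar>gq i - 0\<bar> \<le> 2 * gq (nn k) + 2 * C^2 * d k" using gq_nonneg[of i] by simp
  next
    have "(\<lambda>k. 2 * gq (nn k) + 2 * C^2 * d k) \<longlonglongrightarrow> 2 * 0 + 2 * C^2 * 0"
      by (intro tendsto_intros nn(6) d0)
    thus "(\<lambda>k. 2 * gq (nn k) + 2 * C^2 * d k) \<longlonglongrightarrow> 0" by simp
  qed
  obtain l where l: "(\<lambda>k. h (nn k)) \<longlonglongrightarrow> l" using nn(5) by (auto simp: convergent_def)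
  have hq: "h k = q k - qbar + kap * gq k" for k
    unfolding h_def H_def q_def gq_def using Q_integrable G_sq_integrable by (simp add: prob_space)
  have "(\<lambda>k. h (nn k) + qbar - kap * gq (nn k)) \<longlonglongrightarrow> l + qbar - kap * 0"
    by (intro tendsto_intros l nn(6))
  hence ql: "(\<lambda>k. q (nn k)) \<longlonglongrightarrow> l + qbar" by (simp add: hq)
  have "q \<longlonglongrightarrow> l + qbar"
  proof (rule tendsto_from_windows[OF nn(1)])
    fix k i assume ki: "nn k \<le> i" "i \<le> nn (Suc k)"
    note di = displacement_integrable[OF ki(1) short[OF ki]]
    have "\<bar>q i - q (nn k)\<bar> = \<bar>\<integral>\<omega>. Q (z i \<omega>) - Q (z (nn k) \<omega>) \<partial>M\<bar>"
      unfolding q_def using Q_integrable by simp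
    also have "\<dots> \<le> (\<integral>\<omega>. \<bar>Q (z i \<omega>) - Q (z (nn k) \<omega>)\<bar> \<partial>M)" by (rule integral_abs_bound)
    also have "\<dots> \<le> (\<integral>\<omega>. norm (G (z (nn k) \<omega>))^2 + (C + 1) * norm (z i \<omega> - z (nn k) \<omega>)^2 \<partial>M)"
      using Q_integrable G_sq_integrable di by (intro integral_mono Q_diff_sq) auto
    also have "\<dots> = gq (nn k) + (C + 1) * (\<integral>\<omega>. norm (z i \<omega> - z (nn k) \<omega>)^2 \<partial>M)"
      using G_sq_integrable di by (simp add: gq_def)
    also have "\<dots> \<le> gq (nn k) + (C + 1) * d k"
      using disp[OF ki] C_pos by (intro add_mono mult_left_mono) auto
    finally show "\<bar>q i - (l + qbar)\<bar> \<le> \<bar>q (nn k) - (l + qbar)\<bar> + (gq (nn k) + (C + 1) * d k)" by linarith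
  next
    have "(\<lambda>k. \<bar>q (nn k) - (l + qbar)\<bar> + (gq (nn k) + (C + 1) * d k)) \<longlonglongrightarrow> \<bar>(l + qbar) - (l + qbar)\<bar> + (0 + (C + 1) * 0)"
      by (intro tendsto_intros nn(6) d0 ql)
    thus "(\<lambda>k. \<bar>q (nn k) - (l + qbar)\<bar> + (gq (nn k) + (C + 1) * d k)) \<longlonglongrightarrow> 0" by simp
  qed
  thus "convergent (\<lambda>k. \<integral>\<omega>. Q (z k \<omega>) \<partial>M)" unfolding q_def convergent_def by blast
qed

text \<open>The expectations of \<open>R\<close> over the windows are summable, so the sum of
  \<open>R\<close> is almost surely finite; the deterministic path lemma then applies to almost
  every \<omega>.\<close>

theorem almost_sure_limits:
  "AE \<omega> in M. (\<lambda>k. norm (G (z k \<omega>))) \<longlonglongrightarrow> 0 \<and> convergent (\<lambda>k. Q (z k \<omega>))"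
proof -
  obtain nn where nn: "strict_mono nn"
    "\<And>k. T / 2 \<le> (\<Sum>j=nn k..<nn (Suc k). \<alpha> j)" "\<And>k. (\<Sum>j=nn k..<nn (Suc k). \<alpha> j) \<le> T"
    "summable (\<lambda>k. V (nn k) (nn (Suc k)))" "convergent (\<lambda>k. h (nn k))" "(\<lambda>k. gq (nn k)) \<longlonglongrightarrow> 0"
    using good_windows by blast
  have mono: "nn k \<le> nn (Suc k)" for k using nn(1) by (simp add: strict_mono_less_eq)
  note iR = R_integrable[OF mono nn(3)]
  have sR: "AE \<omega> in M. summable (\<lambda>k. path.R \<omega> (nn k) (nn (Suc k)))"
  proof -
    have "(\<integral>\<^sup>+ \<omega>. (\<Sum>k. ennreal (path.R \<omega> (nn k) (nn (Suc k)))) \<partial>M)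
        = (\<Sum>k. \<integral>\<^sup>+ \<omega>. ennreal (path.R \<omega> (nn k) (nn (Suc k))) \<partial>M)"
      using iR by (intro nn_integral_suminf) (auto dest: borel_measurable_integrable)
    also have "\<dots> = (\<Sum>k. ennreal (\<integral>\<omega>. path.R \<omega> (nn k) (nn (Suc k)) \<partial>M))"
      using iR by (intro suminf_cong nn_integral_eq_integral) (auto simp: path.R_nonneg)
    also have "\<dots> \<le> (\<Sum>k. ennreal (2 * V (nn k) (nn (Suc k))))"
      using R_expectation[OF mono nn(3)] by (intro suminf_le ennreal_leI) auto
    also have "\<dots> = ennreal (\<Sum>k. 2 * V (nn k) (nn (Suc k)))"
      by (intro suminf_ennreal2 summable_mult nn(4)) (auto simp: V_nonneg)
    also have "\<dots> < \<infinity>" by simp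
    finally have "AE \<omega> in M. (\<Sum>k. ennreal (path.R \<omega> (nn k) (nn (Suc k)))) \<noteq> \<infinity>"
      using iR by (intro nn_integral_PInf_AE) (auto dest: borel_measurable_integrable)
    thus ?thesis
      by eventually_elim (auto intro!: summable_suminf_not_top path.R_nonneg)
  qed
  have mx: "AE \<omega> in M. \<forall>\<^sub>F k in sequentially. \<forall>i\<in>{nn k..nn (Suc k)}. norm (path.noise \<omega> (nn k) i) < 1 / real (Suc p)" for p
  proof -
    define X where "X k = {\<omega>\<in>space M. \<exists>i\<in>{nn k..nn (Suc k)}. 1 / real (Suc p) \<le> norm (path.noise \<omega> (nn k) i)}" for k
    note mi = noise_maximal_inequality[OF mono, of "1 / real (Suc p)"]
    have "summable (\<lambda>k. measure M (X k))"
    proof (rule summable_comparison_test)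
      show "summable (\<lambda>k. V (nn k) (nn (Suc k)) / (1 / real (Suc p))^2)"
        by (rule summable_divide[OF nn(4)])
      show "\<exists>N. \<forall>k\<ge>N. norm (measure M (X k)) \<le> V (nn k) (nn (Suc k)) / (1 / real (Suc p))^2"
        using mi(2) unfolding X_def by simp
    qed
    moreover have "X k \<in> sets M" for k unfolding X_def by (rule mi(1)) simp
    ultimately have "AE \<omega> in M. eventually (\<lambda>k. \<omega> \<in> space M - X k) sequentially"
      by (intro borel_cantelli_AE1) (auto simp: emeasure_eq_measure)
    thus ?thesis
      by eventually_elim (auto simp: X_def not_le elim: eventually_mono)
  qed
  have "AE \<omega> in M. \<forall>p. \<forall>\<^sub>F k in sequentially. \<forall>i\<in>{nn k..nn (Suc k)}. norm (path.noise \<omega> (nn k) i) < 1 / real (Suc p)"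
    using mx by (simp only: AE_all_countable) blast
  with sR show ?thesis
  proof eventually_elim
    case (elim \<omega>)
    show ?case using path.window_path_limits[OF nn(1,2,3), of \<omega>] elim by blast
  qed
qed

end

section \<open>Convergence of the stochastic proximal gradient method\<close>

theorem theorem2p14:
  fixes M :: "'w measure" and F :: "nat \<Rightarrow> 'w measure"
    and \<phi> :: "'a::euclidean_space \<Rightarrow> ereal" and f :: "'a \<Rightarrow> real" and f' :: "'a \<Rightarrow> 'a"
    and lam :: real and \<alpha> :: "nat \<Rightarrow> real" and z0 :: 'a
    and g :: "nat \<Rightarrow> 'w \<Rightarrow> 'a" and z x :: "nat \<Rightarrow> 'w \<Rightarrow> 'a"
    and \<psi>bar A L :: real and \<sigma> :: "nat \<Rightarrow> real"
  assumes prob: "prob_space M"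
    and filt: "filtration (space M) F" and subalg: "\<And>k. subalgebra M (F k)"
    and phi_convex: "ext_convex \<phi>" and phi_lsc: "lsc \<phi>" and phi_proper: "proper_fun \<phi>"
    and f_grad: "\<And>y. GDERIV f y :> f' y" and f'_cont: "continuous_on UNIV f'"
    and lam_pos: "lam > 0" and alpha_pos: "\<And>k. \<alpha> k > 0"
    and z_0: "\<And>\<omega>. z 0 \<omega> = z0"
    and z_Suc: "\<And>k \<omega>. z (Suc k) \<omega> = z k \<omega> - \<alpha> k *\<^sub>R (g k \<omega> + grad_env lam \<phi> (z k \<omega>))"
    and x_def: "\<And>k \<omega>. x k \<omega> = prox lam \<phi> (z k \<omega>)"
    and g_meas: "\<And>k. g k \<in> borel_measurable (F (Suc k))"
    \<comment> \<open>(A.1)\<close>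
    and A1: "\<And>y. y \<in> dom_fun \<phi> \<Longrightarrow> psi f \<phi> y \<ge> ereal \<psi>bar"
    \<comment> \<open>(A.3)\<close>
    and A3_div: "\<not> summable \<alpha>" and A3_lim: "\<alpha> \<longlonglongrightarrow> 0"
    \<comment> \<open>(B.1)\<close>
    and B1: "L > 0" "L-lipschitz_on UNIV f'"
    \<comment> \<open>(B.2)\<close>
    and B2_int: "\<And>k. integrable M (g k)"
    and B2_unbiased: "\<And>k b. b \<in> Basis \<Longrightarrow>
        AE \<omega> in M. real_cond_exp M (F k) (\<lambda>\<omega>. g k \<omega> \<bullet> b) \<omega> = f' (x k \<omega>) \<bullet> b"
    and B2_A: "A \<ge> 0" and B2_sigma: "\<And>k. \<sigma> k \<ge> 0"
    and B2_var: "\<And>k. AE \<omega> in M.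
        nn_cond_exp M (F k) (\<lambda>\<omega>. ennreal ((norm (g k \<omega> - f' (x k \<omega>)))^2)) \<omega>
          \<le> ennreal ((\<sigma> k)^2 + A * (real_of_ereal (psi f \<phi> (x k \<omega>)) - \<psi>bar))"
    and step_sum: "summable (\<lambda>k. (\<alpha> k)^2 * max A ((\<sigma> k)^2))"
  shows "(\<exists>\<psi>s \<in> borel_measurable M. AE \<omega> in M.
            (\<lambda>k. norm (F_nor lam f' \<phi> (z k \<omega>))) \<longlonglongrightarrow> 0 \<and>
            (\<lambda>k. norm (F_nat lam f' \<phi> (x k \<omega>))) \<longlonglongrightarrow> 0 \<and>
            (\<lambda>k. psi f \<phi> (x k \<omega>)) \<longlonglongrightarrow> ereal (\<psi>s \<omega>))
       \<and> (\<lambda>k. \<integral>\<^sup>+ \<omega>. ennreal ((norm (F_nor lam f' \<phi> (z k \<omega>)))^2) \<partial>M) \<longlonglongrightarrow> 0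
       \<and> (\<lambda>k. \<integral>\<^sup>+ \<omega>. ennreal ((norm (F_nat lam f' \<phi> (x k \<omega>)))^2) \<partial>M) \<longlonglongrightarrow> 0
       \<and> (\<exists>\<rho>::real. (\<forall>\<^sub>F k in sequentially. integrable M (\<lambda>\<omega>. real_of_ereal (psi f \<phi> (x k \<omega>))))
            \<and> (\<lambda>k. \<integral>\<omega>. real_of_ereal (psi f \<phi> (x k \<omega>)) \<partial>M) \<longlonglongrightarrow> \<rho>)"
proof -
  interpret cp: composite_problem \<phi> f f' lam L
    by unfold_locales (fact assms)+
  interpret prob_space M by (rule prob)
  define e where "e k \<omega> = g k \<omega> - f' (x k \<omega>)" for k \<omega>
  have P_borel: "cp.P \<in> borel_measurable borel"
  proof (intro borel_measurable_continuous_onI lipschitz_on_continuous_on)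
    show "1-lipschitz_on UNIV cp.P"
      using cp.nonexp by (intro lipschitz_onI) (auto simp: dist_norm)
  qed
  have f'_borel: "f' \<in> borel_measurable borel"
    by (rule borel_measurable_continuous_onI[OF f'_cont])
  have F_mono: "X \<in> borel_measurable (F (Suc k))" if "X \<in> borel_measurable (F k)" for X :: "'w \<Rightarrow> 'a" and k
    using filt that unfolding filtration_def
    by (intro measurable_from_subalg[of "F (Suc k)" "F k"]) (auto simp: subalgebra_def)
  have z_meas: "z k \<in> borel_measurable (F k)" for k
  proof (induction k)
    case 0
    have "z 0 = (\<lambda>_. z0)" using z_0 by auto
    thus ?case by simp
  next
    case (Suc k)
    have [measurable]: "z k \<in> borel_measurable (F (Suc k))" by (rule F_mono[OF Suc])
    have [measurable]: "(\<lambda>\<omega>. cp.P (z k \<omega>)) \<in> borel_measurable (F (Suc k))"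
      by (rule measurable_compose[OF _ P_borel]) measurable
    note g_meas[of k, measurable]
    have "(\<lambda>\<omega>. z k \<omega> - \<alpha> k *\<^sub>R (g k \<omega> + (1 / lam) *\<^sub>R (z k \<omega> - cp.P (z k \<omega>)))) \<in> borel_measurable (F (Suc k))"
      by measurable
    moreover have "z (Suc k) = (\<lambda>\<omega>. z k \<omega> - \<alpha> k *\<^sub>R (g k \<omega> + (1 / lam) *\<^sub>R (z k \<omega> - cp.P (z k \<omega>))))"
      using z_Suc by (auto simp: grad_env_def)
    ultimately show ?case by simp
  qed
  have fx_meas: "(\<lambda>\<omega>. f' (x k \<omega>)) \<in> borel_measurable (F k)" for k
    unfolding x_def
    by (intro measurable_compose[OF _ f'_borel] measurable_compose[OF _ P_borel] z_meas)
  have psi_x: "psi f \<phi> (x k \<omega>) = ereal (cp.Q (z k \<omega>))" for k \<omega>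
    unfolding x_def by (rule cp.psi_prox)
  \<comment> \<open>\<open>4 * cp.K\<close> is dictated by \<open>Q_diff\<close> and exceeds the
    Lipschitz constant 2 K of the normal map; the last four constants are read off from
    \<open>merit_descent\<close>.\<close>
  interpret stochastic_drift cp.G cp.Q "4 * cp.K" \<psi>bar cp.kap "cp.kap / lam" "2 + 2 * cp.kap / lam"
    "1 / (8 * cp.K)" M F \<alpha> z0 z e A \<sigma>
  proof unfold_locales
    show "norm (cp.G w - cp.G y) \<le> 4 * cp.K * norm (w - y)" for w y
    proof -
      have "2 * cp.K * norm (w - y) \<le> 4 * cp.K * norm (w - y)"
        using cp.K_bounds(1) by (intro mult_right_mono) auto
      thus ?thesis using cp.G_lipschitz[of w y] by linarith
    qed
    show "space (F i) = space M" for i by (rule filtration.space_F[OF filt])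
    show "sets (F i) \<subseteq> sets (F j)" if "i \<le> j" for i j
      by (rule filtration.sets_F_mono[OF filt that])
    show "\<psi>bar \<le> cp.Q y" for y
    proof -
      have "cp.P y \<in> dom_fun \<phi>"
        using phi_prox_finite[OF phi_convex phi_lsc phi_proper lam_pos, of y]
        by (metis (mono_tags) PInfty_neq_ereal(1) dom_fun_def mem_Collect_eq)
      thus ?thesis using A1[of "cp.P y"] cp.psi_prox[of y] by simp
    qed
    show "cp.Q (y - t *\<^sub>R (cp.G y + u)) + cp.kap * norm (cp.G (y - t *\<^sub>R (cp.G y + u)))^2
      \<le> cp.Q y + cp.kap * norm (cp.G y)^2 - cp.kap / lam * t * norm (cp.G y)^2 + (2 + 2 * cp.kap / lam) * t * norm u^2"
      if "0 < t" "t \<le> 1 / (8 * cp.K)" for t y u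
      using that cp.K_bounds(1) by (intro cp.merit_descent) (auto simp: field_simps)
    show "z (Suc k) \<omega> = z k \<omega> - \<alpha> k *\<^sub>R (cp.G (z k \<omega>) + e k \<omega>)" for k \<omega>
      by (simp add: z_Suc e_def x_def F_nor_def grad_env_def)
    show "e k \<in> borel_measurable (F (Suc k))" for k
      unfolding e_def[abs_def] using g_meas F_mono[OF fx_meas] by (intro borel_measurable_diff)
    show "AE \<omega> in M. real_cond_exp M (F k) (\<lambda>\<omega>. e k \<omega> \<bullet> b) \<omega> = 0"
      if b: "b \<in> Basis" and ei: "integrable M (e k)" for k b
    proof -
      interpret sf: sigma_finite_subalgebra M "F k"
        using subalg finite_measure_axioms
        by (intro finite_measure_subalgebra_is_sigma_finite)
          (simp add: finite_measure_subalgebra_def finite_measure_subalgebra_axioms_def)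
      \<comment> \<open>Integrability of the gradient along the iterates is obtained by writing it
        as g - e.\<close>
      have "integrable M (\<lambda>\<omega>. g k \<omega> - e k \<omega>)" using B2_int ei by simp
      hence fi: "integrable M (\<lambda>\<omega>. f' (x k \<omega>) \<bullet> b)" by (simp add: e_def)
      have gi: "integrable M (\<lambda>\<omega>. g k \<omega> \<bullet> b)" using B2_int by simp
      have "AE \<omega> in M. real_cond_exp M (F k) (\<lambda>\<omega>. f' (x k \<omega>) \<bullet> b) \<omega> = f' (x k \<omega>) \<bullet> b"
        using fx_meas[of k] by (intro sf.real_cond_exp_F_meas fi) simp
      with sf.real_cond_exp_diff[OF gi fi] B2_unbiased[OF b, of k] show ?thesis
        by eventually_elim (simp add: e_def inner_diff_left)
    qed
    show "AE \<omega> in M. nn_cond_exp M (F k) (\<lambda>\<omega>. ennreal (norm (e k \<omega>)^2)) \<omega>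
        \<le> ennreal ((\<sigma> k)^2 + A * (cp.Q (z k \<omega>) - \<psi>bar))" for k
      using B2_var[of k] unfolding psi_x by (simp add: e_def)
  qed (use assms cp.K_bounds cp.kap_pos cp.Q_diff z_meas in \<open>auto intro: add_pos_nonneg\<close>)
  \<comment> \<open>\<open>lim\<close> is defined for every \<omega>, which makes the random
    variable measurable on the whole space; it is the actual limit almost surely.\<close>
  define \<psi>s where "\<psi>s \<omega> = lim (\<lambda>k. cp.Q (z k \<omega>))" for \<omega>
  have nat0: "norm (F_nat lam f' \<phi> (x k \<omega>)) \<le> lam * norm (cp.G (z k \<omega>))" for k \<omega>
    unfolding x_def by (rule cp.F_nat_le_F_nor)
  have "\<psi>s \<in> borel_measurable M" unfolding \<psi>s_def by measurable
  moreover have "AE \<omega> in M. (\<lambda>k. norm (cp.G (z k \<omega>))) \<longlonglongrightarrow> 0 \<and>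
            (\<lambda>k. norm (F_nat lam f' \<phi> (x k \<omega>))) \<longlonglongrightarrow> 0 \<and>
            (\<lambda>k. psi f \<phi> (x k \<omega>)) \<longlonglongrightarrow> ereal (\<psi>s \<omega>)"
    using almost_sure_limits
  proof eventually_elim
    case (elim \<omega>)
    hence "(\<lambda>k. lam * norm (cp.G (z k \<omega>))) \<longlonglongrightarrow> lam * 0" by (intro tendsto_intros) auto
    hence "(\<lambda>k. norm (F_nat lam f' \<phi> (x k \<omega>))) \<longlonglongrightarrow> 0"
      by (intro Lim_null_comparison[of "\<lambda>k. norm (F_nat lam f' \<phi> (x k \<omega>))" "\<lambda>k. lam * norm (cp.G (z k \<omega>))"])
        (use nat0 in auto)
    moreover have "(\<lambda>k. cp.Q (z k \<omega>)) \<longlonglongrightarrow> \<psi>s \<omega>"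
      using elim unfolding \<psi>s_def by (simp add: convergent_LIMSEQ_iff)
    ultimately show ?case using elim by (simp add: psi_x)
  qed
  moreover have nnG: "(\<integral>\<^sup>+ \<omega>. ennreal (norm (cp.G (z k \<omega>))^2) \<partial>M) = ennreal (gq k)" for k
    unfolding gq_def by (intro nn_integral_eq_integral G_sq_integrable) auto
  have "(\<lambda>k. \<integral>\<^sup>+ \<omega>. ennreal (norm (cp.G (z k \<omega>))^2) \<partial>M) \<longlonglongrightarrow> 0"
    unfolding nnG using tendsto_ennrealI[OF expectation_limits(1)] by simp
  moreover have "(\<lambda>k. \<integral>\<^sup>+ \<omega>. ennreal (norm (F_nat lam f' \<phi> (x k \<omega>))^2) \<partial>M) \<longlonglongrightarrow> 0"
  proof (rule tendsto_sandwich[OF _ _ tendsto_const])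
    have "(\<lambda>k. ennreal (lam^2 * gq k)) \<longlonglongrightarrow> ennreal (lam^2 * 0)"
      by (intro tendsto_ennrealI tendsto_intros expectation_limits(1))
    thus "(\<lambda>k. ennreal (lam^2 * gq k)) \<longlonglongrightarrow> 0" by simp
    have "(\<integral>\<^sup>+ \<omega>. ennreal (norm (F_nat lam f' \<phi> (x k \<omega>))^2) \<partial>M) \<le> ennreal (lam^2 * gq k)" for k
    proof -
      have "(\<integral>\<^sup>+ \<omega>. ennreal (norm (F_nat lam f' \<phi> (x k \<omega>))^2) \<partial>M)
          \<le> (\<integral>\<^sup>+ \<omega>. ennreal (lam^2 * norm (cp.G (z k \<omega>))^2) \<partial>M)"
      proof (intro nn_integral_mono ennreal_leI)
        fix \<omega>
        show "norm (F_nat lam f' \<phi> (x k \<omega>))^2 \<le> lam^2 * norm (cp.G (z k \<omega>))^2"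
          using power_mono[OF nat0[of k \<omega>], of 2] by (simp add: power_mult_distrib)
      qed
      also have "\<dots> = ennreal (\<integral>\<omega>. lam^2 * norm (cp.G (z k \<omega>))^2 \<partial>M)"
        using G_sq_integrable[of k] by (intro nn_integral_eq_integral) auto
      finally show ?thesis by (simp add: gq_def)
    qed
    thus "\<forall>\<^sub>F k in sequentially. (\<integral>\<^sup>+ \<omega>. ennreal (norm (F_nat lam f' \<phi> (x k \<omega>))^2) \<partial>M) \<le> ennreal (lam^2 * gq k)"
      by simp
  qed simp
  moreover have "\<exists>\<rho>::real. (\<forall>\<^sub>F k in sequentially. integrable M (\<lambda>\<omega>. real_of_ereal (psi f \<phi> (x k \<omega>))))
            \<and> (\<lambda>k. \<integral>\<omega>. real_of_ereal (psi f \<phi> (x k \<omega>)) \<partial>M) \<longlonglongrightarrow> \<rho>"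
    using expectation_limits(2) Q_integrable unfolding psi_x convergent_def by simp
  ultimately show ?thesis by blast
qed

end
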